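(* Let $k>0$ be an integer. There is an injective algebra homomorphism $$\phi_k:Y_3^+(k)\to Y_3^+(k-1)\otimes U(\mathfrak{gl}_1(\mathbb C))$$ given on generators by $$\phi_k(D_{i,j}^{(m)})=D_{i,j}^{(m)}\otimes1\quad(i,j\in\{\pm1\},\ m\ge0),$$ $$\phi_k(E_i^{(m)})=E_i^{(m)}\otimes1+E_i^{(m-1)}\otimes e_{0,0}\quad(i\in\{\pm1\},\ m>k),$$ $$\phi_k(G^{(m)})=G^{(m)}\otimes1-\Big(\sum_{l=1}^{m-1}(-2)^lG^{(m-l-1)}\Big)\otimes e_{0,0}-\Big(\sum_{l=0}^{m-2}(-2)^lG^{(m-l-2)}\Big)\otimes e_{0,0}^2\quad(m\ge0),$$ where $e_{0,0}$ is the standard basis element of $\mathfrak{gl}_1(\mathbb C)$ and empty sums are $0$.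
   Context: **The twisted Yangian $Y_3^+$.** Let $\mathcal I=\{-1,0,1\}$. The Yangian $Y_3$ is the associative unital $\mathbb{C}$-algebra with generators $T_{i,j}^{(r)}$ ($i,j\in\mathcal I$, $r\ge1$) and relations $[T_{i,j}(u),T_{k,l}(v)]=\frac1{u-v}\big(T_{k,j}(u)T_{i,l}(v)-T_{k,j}(v)T_{i,l}(u)\big)$, where $T_{i,j}(u)=\sum_{r\ge0}T_{i,j}^{(r)}u^{-r}$, $T_{i,j}^{(0)}=\delta_{i,j}$, and $\frac1{u-v}=\sum_{r\ge0}u^{-r-1}v^r$. There is an involutive automorphism $\eta$ of $Y_3$ with $\eta(T_{i,j}(u))=T_{-j,-i}(-u)$. Put $S_{i,j}(u)=\sum_{r\ge0}S_{i,j}^{(r)}u^{-r}=\sum_{k\in\mathcal I}\eta(T_{i,k}(u))T_{k,j}(u)$. Then $Y_3^+$, the twisted Yangian associated to $\mathfrak{so}_3(\mathbb C)$, is the subalgebra of $Y_3$ generated by all $S_{i,j}^{(r)}$, $i,j\in\mathcal I$, $r\ge1$. **Drinfeld generators.** For $i,j\in\{\pm1\}$ let $D_{i,j}(u)=S_{i,j}(u)$, let $D(u)$ be the $2\times2$ matrix $(D_{i,j}(u))_{i,j\in\{\pm1\}}$, and let $\tilde D(u)=(\tilde D_{i,j}(u))=D(u)^{-1}$. Define, with sums over $a,b\in\{\pm1\}$, $E_i(u)=\sum_a\tilde D_{i,a}(u)S_{a,0}(u)$ and $G(u)=S_{0,0}(u)-\sum_{a,b}S_{0,a}(u)\tilde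 D_{a,b}(u)S_{b,0}(u)$. For $X\in\{D_{i,j},E_i,G\}$, $X^{(r)}\in Y_3^+$ denotes the coefficient of $u^{-r}$ in $X(u)$. **Shifted twisted Yangians.** For $k\ge0$, the $k$-shifted twisted Yangian $Y_3^+(k)$ is the subalgebra of $Y_3^+$ generated by $\{D_{i,j}^{(m)},G^{(n)},E_l^{(r)}\mid i,j,l\in\{\pm1\},\ m,n\ge0,\ r>k\}$; in particular $Y_3^+(0)=Y_3^+$. *)

theory Defs
  imports "HOL-Analysis.Analysis" "HOL-Library.Poly_Mapping"
    "HOL-Computational_Algebra.Formal_Power_Series"
begin

section \<open>Complex algebras\<close>

text \<open>Associative unital algebras over the complex numbers. Unlike for \<^class>\<open>real_algebra_1\<close>,
  the zero algebra is allowed.\<close>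

class complex_algebra = ring + monoid_mult +
  fixes scaleC :: "complex \<Rightarrow> 'a \<Rightarrow> 'a"  (infixr \<open>*\<^sub>C\<close> 75)
  assumes scaleC_add_right: "c *\<^sub>C (x + y) = c *\<^sub>C x + c *\<^sub>C y"
    and scaleC_add_left: "(c + d) *\<^sub>C x = c *\<^sub>C x + d *\<^sub>C x"
    and scaleC_scaleC: "c *\<^sub>C d *\<^sub>C x = (c * d) *\<^sub>C x"
    and scaleC_one: "1 *\<^sub>C x = x"
    and mult_scaleC_left: "(c *\<^sub>C x) * y = c *\<^sub>C (x * y)"
    and mult_scaleC_right: "x * (c *\<^sub>C y) = c *\<^sub>C (x * y)"

definition subalgebra :: "'a::complex_algebra set \<Rightarrow> bool" where
  "subalgebra A \<longleftrightarrow> 1 \<in> A \<and> (\<forall>x\<in>A. \<forall>y\<in>A. x + y \<in> A \<and> x * y \<in> A) \<and> (\<forall>c. \<forall>x\<in>A. c *\<^sub>C x \<in> A)"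

text \<open>\<open>f\<close> restricts to a unital algebra homomorphism on the subalgebra \<open>A\<close>; the values of \<open>f\<close>
  outside \<open>A\<close> are irrelevant.\<close>

definition alg_hom_on :: "'a::complex_algebra set \<Rightarrow> ('a \<Rightarrow> 'b::complex_algebra) \<Rightarrow> bool" where
  "alg_hom_on A f \<longleftrightarrow> f 1 = 1
     \<and> (\<forall>x\<in>A. \<forall>y\<in>A. f (x + y) = f x + f y \<and> f (x * y) = f x * f y)
     \<and> (\<forall>c. \<forall>x\<in>A. f (c *\<^sub>C x) = c *\<^sub>C f x)"

definition two_sided_ideal :: "'a::ring_1 set \<Rightarrow> bool" where
  "two_sided_ideal I \<longleftrightarrow> 0 \<in> I \<and> (\<forall>x\<in>I. \<forall>y\<in>I. x + y \<in> I) \<and> (\<forall>r. \<forall>x\<in>I. r * x \<in> I \<and> x * r \<in> I)"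

lemma two_sided_ideal_hull: "two_sided_ideal (two_sided_ideal hull R)"
  by (rule hull_in) (auto simp: two_sided_ideal_def)

context
  fixes I :: "'a::ring_1 set"
  assumes I: "two_sided_ideal I"
begin

lemma ideal_zero: "0 \<in> I"
  and ideal_add: "x \<in> I \<Longrightarrow> y \<in> I \<Longrightarrow> x + y \<in> I"
  and ideal_mult_left: "x \<in> I \<Longrightarrow> r * x \<in> I"
  and ideal_mult_right: "x \<in> I \<Longrightarrow> x * r \<in> I"
  using I by (auto simp: two_sided_ideal_def)

lemma ideal_cong_refl: "x = y \<Longrightarrow> x - y \<in> I"
  by (simp add: ideal_zero)

lemma ideal_uminus: "x \<in> I \<Longrightarrow> - x \<in> I"
  using ideal_mult_left[of x "- 1"] by simp

lemma ideal_equivp: "equivp (\<lambda>x y. x - y \<in> I)"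
proof (rule equivpI)
  show "reflp (\<lambda>x y. x - y \<in> I)" by (simp add: reflp_def ideal_zero)
  show "symp (\<lambda>x y. x - y \<in> I)" using ideal_uminus by (fastforce simp: symp_def)
  show "transp (\<lambda>x y. x - y \<in> I)" using ideal_add by (fastforce simp: transp_def)
qed

lemma ideal_cong_add: "x - x' \<in> I \<Longrightarrow> y - y' \<in> I \<Longrightarrow> (x + y) - (x' + y') \<in> I"
  using ideal_add[of "x - x'" "y - y'"] by (simp add: algebra_simps)

lemma ideal_cong_uminus: "x - x' \<in> I \<Longrightarrow> (- x) - (- x') \<in> I"
  using ideal_uminus[of "x - x'"] by (simp add: algebra_simps)

lemma ideal_cong_diff: "x - x' \<in> I \<Longrightarrow> y - y' \<in> I \<Longrightarrow> (x - y) - (x' - y') \<in> I"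
  using ideal_add[OF _ ideal_uminus, of "x - x'" "y - y'"] by (simp add: algebra_simps)

lemma ideal_cong_mult: "x - x' \<in> I \<Longrightarrow> y - y' \<in> I \<Longrightarrow> x * y - x' * y' \<in> I"
  using ideal_add[OF ideal_mult_right[of "x - x'" y] ideal_mult_left[of "y - y'" x']]
  by (simp add: algebra_simps)

end


section \<open>Free algebras\<close>

text \<open>Words form the free monoid, written additively because the library's monoid algebra
  \<^typ>\<open>'m \<Rightarrow>\<^sub>0 complex\<close> multiplies basis elements by adding the keys. Hence
  \<open>'g free_word \<Rightarrow>\<^sub>0 complex\<close> is the free associative unital algebra on \<open>'g\<close>.\<close>

datatype 'g free_word = Word "'g list"

instantiation free_word :: (type) monoid_add
begin
definition zero_free_word :: "'a free_word" where "0 = Word []"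
fun plus_free_word :: "'a free_word \<Rightarrow> 'a free_word \<Rightarrow> 'a free_word" where "Word v + Word w = Word (v @ w)"
instance
proof
  fix a b c :: "'a free_word"
  show "a + b + c = a + (b + c)" by (cases a; cases b; cases c) simp
  show "0 + a = a" "a + 0 = a" by (cases a; simp add: zero_free_word_def)+
qed
end

type_synonym 'g free_algebra = "'g free_word \<Rightarrow>\<^sub>0 complex"

definition free_gen :: "'g \<Rightarrow> 'g free_algebra" where
  "free_gen g = Poly_Mapping.single (Word [g]) 1"

definition free_scale :: "complex \<Rightarrow> ('m \<Rightarrow>\<^sub>0 complex) \<Rightarrow> ('m \<Rightarrow>\<^sub>0 complex)" where
  "free_scale c = Poly_Mapping.map ((*) c)"

lemma free_scale_mult: "free_scale c p = Poly_Mapping.single (0::'m::monoid_add) c * p"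
  by (simp add: free_scale_def mult_map_scale_conv_mult)

lemma lookup_free_scale: "Poly_Mapping.lookup (free_scale c p) w = c * Poly_Mapping.lookup p w"
  by (simp add: free_scale_def Poly_Mapping.map.rep_eq when_def)

lemma free_scale_simps:
  "free_scale c (p + q) = free_scale c p + free_scale c q"
  "free_scale (c + d) p = free_scale c p + free_scale d p"
  "free_scale c (free_scale d p) = free_scale (c * d) p"
  "free_scale 1 p = p"
  by (auto intro!: poly_mapping_eqI simp: lookup_free_scale lookup_add algebra_simps)

lemma free_scale_mult_left:
  "free_scale c p * q = free_scale c (p * (q :: 'm::monoid_add \<Rightarrow>\<^sub>0 complex))"
  by (simp add: free_scale_mult mult.assoc)

lemma poly_mapping_single_induct [case_names single add]:
  fixes p :: "'m \<Rightarrow>\<^sub>0 complex"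
  assumes single: "\<And>w c. P (Poly_Mapping.single w c)"
    and add: "\<And>p q. P p \<Longrightarrow> P q \<Longrightarrow> P (p + q)"
  shows "P p"
proof (induction p rule: update_induct)
  case const
  show ?case using single[of undefined 0] by simp
next
  case (update f w c)
  have "Poly_Mapping.update w c f = Poly_Mapping.single w c + f"
    using update(1) by (auto intro!: poly_mapping_eqI
        simp: lookup_add lookup_update lookup_single when_def in_keys_iff)
  then show ?case using add single update by simp
qed

lemma single_commute: "p * Poly_Mapping.single 0 c = Poly_Mapping.single 0 c * p"
  for p :: "'m::monoid_add \<Rightarrow>\<^sub>0 complex"
  by (induction p rule: poly_mapping_single_induct)
    (simp_all add: mult_single distrib_left distrib_right mult.commute)

lemma free_scale_mult_right:
  "p * free_scale c q = free_scale c (p * (q :: 'm::monoid_add \<Rightarrow>\<^sub>0 complex))"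
  by (simp add: free_scale_mult single_commute flip: mult.assoc)

lemma module_free_scale: "module (free_scale :: complex \<Rightarrow> ('m \<Rightarrow>\<^sub>0 complex) \<Rightarrow> _)"
  by unfold_locales (auto simp: free_scale_simps)

lemma ideal_cong_scale:
  "two_sided_ideal I \<Longrightarrow> x - x' \<in> I \<Longrightarrow> free_scale c x - free_scale c (x' :: 'm::monoid_add \<Rightarrow>\<^sub>0 complex) \<in> I"
  using ideal_mult_left[of I "x - x'" "Poly_Mapping.single 0 c"]
  by (simp add: free_scale_mult algebra_simps)


section \<open>The Yangian\<close>

text \<open>Indices are taken in the three-element type \<^typ>\<open>3\<close>, whose elements are \<open>-1, 0, 1\<close> (the residues
  modulo 3); only equality of indices and the involution \<open>i \<mapsto> -i\<close> are used. The free generator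
  \<open>(i, j, r)\<close> stands for $T_{i,j}^{(r+1)}$, and $T_{i,j}^{(0)} = \delta_{i,j}$.\<close>

lemma UNIV_3: "(UNIV :: 3 set) = {-1, 0, 1}" and minus_one_neq_one_3: "(-1::3) \<noteq> 1"
proof -
  show ne: "(-1::3) \<noteq> 1"
    by simp
  have "card {-1, 0, 1 :: 3} = CARD(3)"
    using ne by simp
  then show "(UNIV :: 3 set) = {-1, 0, 1}"
    by (metis card_subset_eq finite subset_UNIV)
qed

fun free_T :: "3 \<Rightarrow> 3 \<Rightarrow> nat \<Rightarrow> (3 \<times> 3 \<times> nat) free_algebra" where
  "free_T i j 0 = (if i = j then 1 else 0)"
| "free_T i j (Suc r) = free_gen (i, j, r)"

text \<open>Coefficient of \<open>u\<^sup>-\<^sup>r v\<^sup>-\<^sup>s\<close> in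
  $[T_{i,j}(u),T_{k,l}(v)] = \sum_{a\ge0} u^{-a-1}v^a (T_{k,j}(u)T_{i,l}(v)-T_{k,j}(v)T_{i,l}(u))$.
  The coefficients of \<open>u\<^sup>-\<^sup>r v\<^sup>t\<close> with \<open>t > 0\<close> vanish identically on both sides.\<close>

definition y3_relations :: "(3 \<times> 3 \<times> nat) free_algebra set" where
  "y3_relations = {free_T i j r * free_T k l s - free_T k l s * free_T i j r
      - (\<Sum>a<r. free_T k j (r - 1 - a) * free_T i l (s + a)
               - free_T k j (s + a) * free_T i l (r - 1 - a)) | i j k l r s. True}"

quotient_type y3 = "(3 \<times> 3 \<times> nat) free_algebra"
  / "\<lambda>x y. x - y \<in> two_sided_ideal hull y3_relations"
  by (rule ideal_equivp[OF two_sided_ideal_hull])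

lemma lookup_mult_zero:
  "Poly_Mapping.lookup (p * q) 0 = Poly_Mapping.lookup p 0 * Poly_Mapping.lookup q (0 :: 'g free_word)"
proof -
  have *: "(0 :: 'g free_word) = v + w \<longleftrightarrow> v = 0 \<and> w = 0" for v w
    by (cases v; cases w) (auto simp: zero_free_word_def)
  have "Poly_Mapping.lookup p l * (\<Sum>q'. Poly_Mapping.lookup q q' when 0 = l + q') =
      (Poly_Mapping.lookup p 0 * Poly_Mapping.lookup q 0 when l = 0)" for l
    by (cases "l = 0") (simp_all add: *)
  then show ?thesis
    by (simp add: times_poly_mapping.rep_eq prod_fun_def)
qed

lemma lookup_free_T: "Poly_Mapping.lookup (free_T i j r) 0 = (if r = 0 \<and> i = j then 1 else 0)"
  by (cases r) (auto simp: free_gen_def zero_free_word_def lookup_single when_def lookup_one)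

lemma one_notin_y3_ideal: "1 \<notin> two_sided_ideal hull y3_relations"
proof -
  have "two_sided_ideal {x :: (3 \<times> 3 \<times> nat) free_algebra. Poly_Mapping.lookup x 0 = 0}"
    by (auto simp: two_sided_ideal_def lookup_mult_zero lookup_add)
  moreover have "y3_relations \<subseteq> {x. Poly_Mapping.lookup x 0 = 0}"
    by (auto simp: y3_relations_def lookup_mult_zero lookup_minus Poly_Mapping.lookup_sum
        lookup_free_T intro!: sum.neutral)
  ultimately have "two_sided_ideal hull y3_relations \<subseteq> {x. Poly_Mapping.lookup x 0 = 0}"
    by (rule hull_minimal[rotated])
  then show ?thesis
    by (auto simp: lookup_one)
qed

instantiation y3 :: "{ring_1, complex_algebra}"
begin
lift_definition zero_y3 :: y3 is 0 .
lift_definition one_y3 :: y3 is 1 .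
lift_definition plus_y3 :: "y3 \<Rightarrow> y3 \<Rightarrow> y3" is "(+)"
  by (rule ideal_cong_add[OF two_sided_ideal_hull])
lift_definition minus_y3 :: "y3 \<Rightarrow> y3 \<Rightarrow> y3" is "(-)"
  by (rule ideal_cong_diff[OF two_sided_ideal_hull])
lift_definition uminus_y3 :: "y3 \<Rightarrow> y3" is uminus
  by (rule ideal_cong_uminus[OF two_sided_ideal_hull])
lift_definition times_y3 :: "y3 \<Rightarrow> y3 \<Rightarrow> y3" is "(*)"
  by (rule ideal_cong_mult[OF two_sided_ideal_hull])
lift_definition scaleC_y3 :: "complex \<Rightarrow> y3 \<Rightarrow> y3" is free_scale
  by (rule ideal_cong_scale[OF two_sided_ideal_hull])
instance
proof
  fix x y z :: "y3" and c d :: complex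
  show "x + y + z = x + (y + z)"
    by (transfer, rule ideal_cong_refl[OF two_sided_ideal_hull], rule add.assoc)
  show "x + y = y + x"
    by (transfer, rule ideal_cong_refl[OF two_sided_ideal_hull], rule add.commute)
  show "0 + x = x"
    by (transfer, rule ideal_cong_refl[OF two_sided_ideal_hull], rule add_0)
  show "- x + x = 0"
    by (transfer, rule ideal_cong_refl[OF two_sided_ideal_hull], rule left_minus)
  show "x - y = x + - y"
    by (transfer, rule ideal_cong_refl[OF two_sided_ideal_hull], rule diff_conv_add_uminus)
  show "x * y * z = x * (y * z)"
    by (transfer, rule ideal_cong_refl[OF two_sided_ideal_hull], rule mult.assoc)
  show "1 * x = x"
    by (transfer, rule ideal_cong_refl[OF two_sided_ideal_hull], rule mult_1_left)
  show "x * 1 = x"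
    by (transfer, rule ideal_cong_refl[OF two_sided_ideal_hull], rule mult_1_right)
  show "(x + y) * z = x * z + y * z"
    by (transfer, rule ideal_cong_refl[OF two_sided_ideal_hull], rule distrib_right)
  show "x * (y + z) = x * y + x * z"
    by (transfer, rule ideal_cong_refl[OF two_sided_ideal_hull], rule distrib_left)
  show "c *\<^sub>C (x + y) = c *\<^sub>C x + c *\<^sub>C y"
    by (transfer, rule ideal_cong_refl[OF two_sided_ideal_hull], rule free_scale_simps)
  show "(c + d) *\<^sub>C x = c *\<^sub>C x + d *\<^sub>C x"
    by (transfer, rule ideal_cong_refl[OF two_sided_ideal_hull], rule free_scale_simps)
  show "c *\<^sub>C d *\<^sub>C x = (c * d) *\<^sub>C x"
    by (transfer, rule ideal_cong_refl[OF two_sided_ideal_hull], rule free_scale_simps)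
  show "1 *\<^sub>C x = x"
    by (transfer, rule ideal_cong_refl[OF two_sided_ideal_hull], rule free_scale_simps)
  show "(c *\<^sub>C x) * y = c *\<^sub>C (x * y)"
    by (transfer, rule ideal_cong_refl[OF two_sided_ideal_hull], rule free_scale_mult_left)
  show "x * (c *\<^sub>C y) = c *\<^sub>C (x * y)"
    by (transfer, rule ideal_cong_refl[OF two_sided_ideal_hull], rule free_scale_mult_right)
  show "(0 :: y3) \<noteq> 1"
    by transfer (use one_notin_y3_ideal ideal_uminus[OF two_sided_ideal_hull, of "- 1" y3_relations] in auto)
qed
end

lift_definition y3_T_coeff :: "3 \<Rightarrow> 3 \<Rightarrow> nat \<Rightarrow> y3" is free_T .

text \<open>Power series in \<open>u\<^sup>-\<^sup>1\<close>: the coefficient of \<open>u\<^sup>-\<^sup>r\<close> is \<open>fps_nth _ r\<close>. The series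
  \<open>y3_eta_T i j\<close> is the image $T_{-j,-i}(-u)$ of $T_{i,j}(u)$ under the automorphism $\eta$.\<close>

definition y3_T :: "3 \<Rightarrow> 3 \<Rightarrow> y3 fps" where
  "y3_T i j = Abs_fps (y3_T_coeff i j)"

definition y3_eta_T :: "3 \<Rightarrow> 3 \<Rightarrow> y3 fps" where
  "y3_eta_T i j = Abs_fps (\<lambda>r. (-1) ^ r * y3_T_coeff (- j) (- i) r)"

definition y3_S :: "3 \<Rightarrow> 3 \<Rightarrow> y3 fps" where
  "y3_S i j = (\<Sum>k\<in>UNIV. y3_eta_T i k * y3_T k j)"

definition y3_plus :: "y3 set" where
  "y3_plus = subalgebra hull {fps_nth (y3_S i j) r | i j r. r \<ge> 1}"


section \<open>Drinfeld generators and shifted twisted Yangians\<close>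

typedef pm = "{-1, 1 :: 3}" morphisms pm_index pm_of
  by blast

instance pm :: finite
proof
  have "finite (pm_of ` {-1, 1 :: 3})" by simp
  moreover have "UNIV = pm_of ` {-1, 1 :: 3}"
    by (metis type_definition.Abs_image type_definition_pm)
  ultimately show "finite (UNIV :: pm set)" by metis
qed

definition y3_D :: "y3 fps ^ pm ^ pm" where
  "y3_D = (\<chi> i j. y3_S (pm_index i) (pm_index j))"

definition y3_Dtilde :: "y3 fps ^ pm ^ pm" where
  "y3_Dtilde = matrix_inv y3_D"

definition y3_E :: "pm \<Rightarrow> y3 fps" where
  "y3_E i = (\<Sum>a\<in>UNIV. y3_Dtilde $ i $ a * y3_S (pm_index a) 0)"

definition y3_G :: "y3 fps" where
  "y3_G = y3_S 0 0 - (\<Sum>a\<in>UNIV. \<Sum>b\<in>UNIV. y3_S 0 (pm_index a) * y3_Dtilde $ a $ b * y3_S (pm_index b) 0)"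

definition y3_plus_shifted :: "nat \<Rightarrow> y3 set" where
  "y3_plus_shifted k = subalgebra hull
     ({fps_nth (y3_D $ i $ j) m | i j m. True} \<union> {fps_nth y3_G n | n. True}
        \<union> {fps_nth (y3_E l) r | l r. r > k})"


text \<open>The series matrix \<open>D(u)\<close> has constant term 1, hence is invertible, with inverse over the
  subalgebra generated by its coefficients.\<close>

fun series_right_inv :: "(nat \<Rightarrow> 'a::ring_1 ^ 'n ^ 'n) \<Rightarrow> nat \<Rightarrow> 'a ^ 'n ^ 'n" where
  "series_right_inv M 0 = mat 1"
| "series_right_inv M (Suc r) = - (\<Sum>s\<le>r. M (Suc s) ** series_right_inv M (r - s))"

fun series_left_inv :: "(nat \<Rightarrow> 'a::ring_1 ^ 'n ^ 'n) \<Rightarrow> nat \<Rightarrow> 'a ^ 'n ^ 'n" where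
  "series_left_inv M 0 = mat 1"
| "series_left_inv M (Suc r) = - (\<Sum>s\<le>r. series_left_inv M (r - s) ** M (Suc s))"

definition matrix_of_coeffs :: "(nat \<Rightarrow> 'a::ring_1 ^ 'n ^ 'n) \<Rightarrow> 'a fps ^ 'n ^ 'n" where
  "matrix_of_coeffs M = (\<chi> i j. Abs_fps (\<lambda>r. M r $ i $ j))"

lemma matrix_of_coeffs_mult:
  fixes M N :: "nat \<Rightarrow> 'a::ring_1 ^ 'n ^ 'n"
  shows "matrix_of_coeffs M ** matrix_of_coeffs N = matrix_of_coeffs (\<lambda>r. \<Sum>s\<le>r. M s ** N (r - s))"
proof -
  have "(\<Sum>k\<in>UNIV. \<Sum>s=0..r. M s $ i $ k * N (r - s) $ k $ j) =
      (\<Sum>s\<le>r. \<Sum>k\<in>UNIV. M s $ i $ k * N (r - s) $ k $ j)" for r i j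
    by (subst sum.swap) (simp add: atMost_atLeast0)
  then show ?thesis
    by (auto simp: matrix_of_coeffs_def matrix_matrix_mult_def vec_eq_iff fps_eq_iff fps_sum_nth
        fps_mult_nth)
qed

lemma matrix_of_coeffs_one:
  "matrix_of_coeffs (\<lambda>r. if r = 0 then mat 1 else 0) = (mat 1 :: 'a::ring_1 fps ^ 'n ^ 'n)"
  by (auto simp: matrix_of_coeffs_def mat_def vec_eq_iff fps_eq_iff)

lemma matrix_of_coeffs_inverse:
  fixes M :: "nat \<Rightarrow> 'a::ring_1 ^ 'n ^ 'n"
  assumes "M 0 = mat 1"
  shows "matrix_of_coeffs M ** matrix_of_coeffs (series_right_inv M) = mat 1"
    and "matrix_of_coeffs (series_left_inv M) ** matrix_of_coeffs M = mat 1"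
proof -
  have "(\<Sum>s\<le>r. M s ** series_right_inv M (r - s)) = (if r = 0 then mat 1 else 0)" for r
  proof (cases r)
    case (Suc r')
    show ?thesis
      unfolding Suc by (subst sum.atMost_Suc_shift) (simp add: assms)
  qed (simp add: assms)
  then show "matrix_of_coeffs M ** matrix_of_coeffs (series_right_inv M) = mat 1"
    by (simp add: matrix_of_coeffs_mult matrix_of_coeffs_one)
  have "(\<Sum>s\<le>r. series_left_inv M s ** M (r - s)) = (if r = 0 then mat 1 else 0)" for r
  proof (cases r)
    case (Suc r')
    have "(\<Sum>s\<le>r. series_left_inv M s ** M (r - s)) = (\<Sum>s\<le>r. series_left_inv M (r - s) ** M s)"
      by (rule sum.reindex_bij_witness[of _ "\<lambda>s. r - s" "\<lambda>s. r - s"]) auto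
    also have "\<dots> = 0"
      unfolding Suc by (subst sum.atMost_Suc_shift) (simp add: assms)
    finally show ?thesis by (simp add: Suc)
  qed (simp add: assms)
  then show "matrix_of_coeffs (series_left_inv M) ** matrix_of_coeffs M = mat 1"
    by (simp add: matrix_of_coeffs_mult matrix_of_coeffs_one)
qed

definition y3_D_coeff :: "nat \<Rightarrow> y3 ^ pm ^ pm" where
  "y3_D_coeff r = (\<chi> i j. fps_nth (y3_D $ i $ j) r)"

lemma y3_T_coeff_0: "y3_T_coeff i j 0 = (if i = j then 1 else 0)"
  by (cases "i = j"; simp; transfer; simp add: ideal_zero[OF two_sided_ideal_hull])

lemma y3_S_coeff_0: "fps_nth (y3_S i j) 0 = (if i = j then 1 else 0)"
proof -
  have "y3_T_coeff (- k) (- i) 0 * y3_T_coeff k j 0 = (if k = i then if i = j then 1 else 0 else 0)" for k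
    by (auto simp: y3_T_coeff_0)
  then show ?thesis
    by (simp add: y3_S_def y3_eta_T_def y3_T_def fps_sum_nth)
qed

lemma y3_D_eq_matrix_of_coeffs: "y3_D = matrix_of_coeffs y3_D_coeff"
  by (simp add: matrix_of_coeffs_def y3_D_coeff_def vec_eq_iff fps_eq_iff)

lemma y3_D_coeff_0: "y3_D_coeff 0 = mat 1"
  by (simp add: y3_D_coeff_def y3_D_def y3_S_coeff_0 mat_def vec_eq_iff pm_index_inject)

lemma y3_Dtilde:
  shows y3_D_Dtilde: "y3_D ** y3_Dtilde = mat 1"
    and y3_Dtilde_D: "y3_Dtilde ** y3_D = mat 1"
    and y3_Dtilde_eq: "y3_Dtilde = matrix_of_coeffs (series_right_inv y3_D_coeff)"
proof -
  define R where "R = matrix_of_coeffs (series_right_inv y3_D_coeff)"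
  define L where "L = matrix_of_coeffs (series_left_inv y3_D_coeff)"
  have R: "y3_D ** R = mat 1" and L: "L ** y3_D = mat 1"
    using matrix_of_coeffs_inverse[where M = y3_D_coeff, OF y3_D_coeff_0]
    by (simp_all add: R_def L_def y3_D_eq_matrix_of_coeffs)
  have unique: "X = R" if "X ** y3_D = mat 1" for X
    by (metis R that matrix_mul_assoc matrix_mul_lid matrix_mul_rid)
  have "\<exists>X. y3_D ** X = mat 1 \<and> X ** y3_D = mat 1"
    using R L unique by metis
  then have "y3_D ** y3_Dtilde = mat 1 \<and> y3_Dtilde ** y3_D = mat 1"
    unfolding y3_Dtilde_def matrix_inv_def by (rule someI_ex)
  then show "y3_D ** y3_Dtilde = mat 1" "y3_Dtilde ** y3_D = mat 1"
    "y3_Dtilde = matrix_of_coeffs (series_right_inv y3_D_coeff)"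
    using unique R_def by auto
qed

lemma subalgebra_hull: "subalgebra (subalgebra hull X)"
  by (rule hull_in) (auto simp: subalgebra_def)

lemma scaleC_zero_left: "0 *\<^sub>C x = (0 :: 'a::complex_algebra)"
  using scaleC_add_left[of 0 0 x] by simp

lemma scaleC_minus_one: "(-1) *\<^sub>C x = - (x :: 'a::complex_algebra)"
  using scaleC_add_left[of "-1" 1 x]
  by (simp add: scaleC_zero_left scaleC_one eq_neg_iff_add_eq_0)

context
  fixes A :: "'a::complex_algebra set"
  assumes A: "subalgebra A"
begin

lemma subalgebra_one: "1 \<in> A"
  and subalgebra_add: "x \<in> A \<Longrightarrow> y \<in> A \<Longrightarrow> x + y \<in> A"
  and subalgebra_mult: "x \<in> A \<Longrightarrow> y \<in> A \<Longrightarrow> x * y \<in> A"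
  and subalgebra_scaleC: "x \<in> A \<Longrightarrow> c *\<^sub>C x \<in> A"
  using A by (auto simp: subalgebra_def)

lemma subalgebra_zero: "0 \<in> A"
  using subalgebra_scaleC[OF subalgebra_one, of 0] by (simp add: scaleC_zero_left)

lemma subalgebra_uminus: "x \<in> A \<Longrightarrow> - x \<in> A"
  using subalgebra_scaleC[of x "-1"] by (simp add: scaleC_minus_one)

lemma subalgebra_diff: "x \<in> A \<Longrightarrow> y \<in> A \<Longrightarrow> x - y \<in> A"
  using subalgebra_add[OF _ subalgebra_uminus] by fastforce

lemma subalgebra_sum: "(\<And>i. i \<in> I \<Longrightarrow> f i \<in> A) \<Longrightarrow> sum f I \<in> A"
  by (induction I rule: infinite_finite_induct) (auto intro: subalgebra_zero subalgebra_add)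

end

lemma y3_S_coeff_in: "fps_nth (y3_S i j) r \<in> y3_plus"
proof (cases r)
  case 0
  then show ?thesis
    using subalgebra_hull by (auto simp: y3_S_coeff_0 y3_plus_def intro: subalgebra_zero subalgebra_one)
next
  case (Suc r')
  then show ?thesis
    unfolding y3_plus_def by (intro hull_inc) auto
qed

lemma subalgebra_y3_plus: "subalgebra y3_plus"
  by (simp add: y3_plus_def subalgebra_hull)

lemma y3_D_coeff_in: "fps_nth (y3_D $ i $ j) r \<in> y3_plus"
  by (simp add: y3_D_def y3_S_coeff_in)

lemmas y3_plus_closed =
  subalgebra_add[OF subalgebra_y3_plus] subalgebra_mult[OF subalgebra_y3_plus]
  subalgebra_diff[OF subalgebra_y3_plus] subalgebra_uminus[OF subalgebra_y3_plus]
  subalgebra_sum[OF subalgebra_y3_plus] subalgebra_zero[OF subalgebra_y3_plus]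
  subalgebra_one[OF subalgebra_y3_plus]

lemma y3_Dtilde_coeff_in: "fps_nth (y3_Dtilde $ i $ j) r \<in> y3_plus"
proof (induction r arbitrary: i j rule: less_induct)
  case (less r)
  show ?case
  proof (cases r)
    case 0
    then show ?thesis
      by (simp add: y3_Dtilde_eq matrix_of_coeffs_def mat_def y3_plus_closed)
  next
    case (Suc r')
    have "series_right_inv y3_D_coeff (r' - s) $ k $ j \<in> y3_plus" for s k
      using less.IH[of "r' - s" k j] Suc by (simp add: y3_Dtilde_eq matrix_of_coeffs_def)
    then show ?thesis
      by (auto simp: y3_Dtilde_eq matrix_of_coeffs_def Suc matrix_matrix_mult_def y3_D_coeff_def
          intro!: y3_plus_closed y3_D_coeff_in)
  qed
qed

lemma y3_E_coeff_in: "fps_nth (y3_E i) r \<in> y3_plus"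
  by (auto simp: y3_E_def fps_sum_nth fps_mult_nth
      intro!: y3_plus_closed y3_Dtilde_coeff_in y3_S_coeff_in)

lemma y3_G_coeff_in: "fps_nth y3_G r \<in> y3_plus"
  by (auto simp: y3_G_def fps_sum_nth fps_mult_nth
      intro!: y3_plus_closed y3_Dtilde_coeff_in y3_S_coeff_in)

lemma y3_plus_shifted_subset: "y3_plus_shifted k \<subseteq> y3_plus"
  unfolding y3_plus_shifted_def
  by (rule hull_minimal) (auto simp: subalgebra_y3_plus y3_D_coeff_in y3_E_coeff_in y3_G_coeff_in)


section \<open>The universal enveloping algebra of $\mathfrak{gl}_n$\<close>

text \<open>The free algebra on the vector space of $n\times n$ matrices modulo linearity of the
  inclusion of generators and $AB - BA = [A,B]$.\<close>

definition ugl_relations :: "(complex ^ 'n ^ 'n) free_algebra set" where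
  "ugl_relations =
     {free_gen (A + B) - free_gen A - free_gen B | A B. True}
   \<union> {free_gen (\<chi> i j. c * A $ i $ j) - free_scale c (free_gen A) | c A. True}
   \<union> {free_gen A * free_gen B - free_gen B * free_gen A - free_gen (A ** B - B ** A) | A B. True}"

quotient_type 'n ugl = "(complex ^ 'n ^ 'n) free_algebra"
  / "\<lambda>x y. x - y \<in> two_sided_ideal hull ugl_relations"
  by (rule ideal_equivp[OF two_sided_ideal_hull])

instantiation ugl :: (finite) complex_algebra
begin
lift_definition zero_ugl :: "'a ugl" is 0 .
lift_definition one_ugl :: "'a ugl" is 1 .
lift_definition plus_ugl :: "'a ugl \<Rightarrow> 'a ugl \<Rightarrow> 'a ugl" is "(+)"
  by (rule ideal_cong_add[OF two_sided_ideal_hull])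
lift_definition minus_ugl :: "'a ugl \<Rightarrow> 'a ugl \<Rightarrow> 'a ugl" is "(-)"
  by (rule ideal_cong_diff[OF two_sided_ideal_hull])
lift_definition uminus_ugl :: "'a ugl \<Rightarrow> 'a ugl" is uminus
  by (rule ideal_cong_uminus[OF two_sided_ideal_hull])
lift_definition times_ugl :: "'a ugl \<Rightarrow> 'a ugl \<Rightarrow> 'a ugl" is "(*)"
  by (rule ideal_cong_mult[OF two_sided_ideal_hull])
lift_definition scaleC_ugl :: "complex \<Rightarrow> 'a ugl \<Rightarrow> 'a ugl" is free_scale
  by (rule ideal_cong_scale[OF two_sided_ideal_hull])
instance
proof
  fix x y z :: "'a ugl" and c d :: complex
  show "x + y + z = x + (y + z)"
    by (transfer, rule ideal_cong_refl[OF two_sided_ideal_hull], rule add.assoc)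
  show "x + y = y + x"
    by (transfer, rule ideal_cong_refl[OF two_sided_ideal_hull], rule add.commute)
  show "0 + x = x"
    by (transfer, rule ideal_cong_refl[OF two_sided_ideal_hull], rule add_0)
  show "- x + x = 0"
    by (transfer, rule ideal_cong_refl[OF two_sided_ideal_hull], rule left_minus)
  show "x - y = x + - y"
    by (transfer, rule ideal_cong_refl[OF two_sided_ideal_hull], rule diff_conv_add_uminus)
  show "x * y * z = x * (y * z)"
    by (transfer, rule ideal_cong_refl[OF two_sided_ideal_hull], rule mult.assoc)
  show "1 * x = x"
    by (transfer, rule ideal_cong_refl[OF two_sided_ideal_hull], rule mult_1_left)
  show "x * 1 = x"
    by (transfer, rule ideal_cong_refl[OF two_sided_ideal_hull], rule mult_1_right)
  show "(x + y) * z = x * z + y * z"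
    by (transfer, rule ideal_cong_refl[OF two_sided_ideal_hull], rule distrib_right)
  show "x * (y + z) = x * y + x * z"
    by (transfer, rule ideal_cong_refl[OF two_sided_ideal_hull], rule distrib_left)
  show "c *\<^sub>C (x + y) = c *\<^sub>C x + c *\<^sub>C y"
    by (transfer, rule ideal_cong_refl[OF two_sided_ideal_hull], rule free_scale_simps)
  show "(c + d) *\<^sub>C x = c *\<^sub>C x + d *\<^sub>C x"
    by (transfer, rule ideal_cong_refl[OF two_sided_ideal_hull], rule free_scale_simps)
  show "c *\<^sub>C d *\<^sub>C x = (c * d) *\<^sub>C x"
    by (transfer, rule ideal_cong_refl[OF two_sided_ideal_hull], rule free_scale_simps)
  show "1 *\<^sub>C x = x"
    by (transfer, rule ideal_cong_refl[OF two_sided_ideal_hull], rule free_scale_simps)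
  show "(c *\<^sub>C x) * y = c *\<^sub>C (x * y)"
    by (transfer, rule ideal_cong_refl[OF two_sided_ideal_hull], rule free_scale_mult_left)
  show "x * (c *\<^sub>C y) = c *\<^sub>C (x * y)"
    by (transfer, rule ideal_cong_refl[OF two_sided_ideal_hull], rule free_scale_mult_right)
qed
end

lift_definition ugl_of :: "complex ^ 'n ^ 'n \<Rightarrow> ('n::finite) ugl" is free_gen .

text \<open>The standard basis element $e_{i,j}$. For $\mathfrak{gl}_1$ the index type is \<^typ>\<open>1\<close>, whose only
  element is \<open>0\<close>.\<close>

definition ugl_e :: "'n \<Rightarrow> 'n \<Rightarrow> ('n::finite) ugl" where
  "ugl_e i j = ugl_of (\<chi> a b. if a = i \<and> b = j then 1 else 0)"


section \<open>Tensor products\<close>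

text \<open>The tensor product of algebras: the vector space with basis \<^typ>\<open>'a \<times> 'b\<close> modulo the span of the
  bilinearity relations, with the product induced by componentwise multiplication of pairs. As
  for words, that multiplication is written as addition of keys.\<close>

datatype ('a, 'b) pure_tensor = Pure 'a 'b

instantiation pure_tensor :: (monoid_mult, monoid_mult) monoid_add
begin
definition zero_pure_tensor :: "('a, 'b) pure_tensor" where "0 = Pure 1 1"
fun plus_pure_tensor :: "('a, 'b) pure_tensor \<Rightarrow> ('a, 'b) pure_tensor \<Rightarrow> ('a, 'b) pure_tensor" where
  "Pure a b + Pure a' b' = Pure (a * a') (b * b')"
instance
proof
  fix x y z :: "('a, 'b) pure_tensor"
  show "x + y + z = x + (y + z)" by (cases x; cases y; cases z) (simp add: mult.assoc)
  show "0 + x = x" "x + 0 = x" by (cases x; simp add: zero_pure_tensor_def)+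
qed
end

definition free_pure :: "'a \<Rightarrow> 'b \<Rightarrow> (('a, 'b) pure_tensor \<Rightarrow>\<^sub>0 complex)" where
  "free_pure a b = Poly_Mapping.single (Pure a b) 1"

definition bilinearity_relations ::
    "(('a::complex_algebra, 'b::complex_algebra) pure_tensor \<Rightarrow>\<^sub>0 complex) set" where
  "bilinearity_relations =
     {free_pure (a + a') b - free_pure a b - free_pure a' b | a a' b. True}
   \<union> {free_pure a (b + b') - free_pure a b - free_pure a b' | a b b'. True}
   \<union> {free_pure (c *\<^sub>C a) b - free_scale c (free_pure a b) | c a b. True}
   \<union> {free_pure a (c *\<^sub>C b) - free_scale c (free_pure a b) | c a b. True}"

definition tensor_null ::
    "(('a::complex_algebra, 'b::complex_algebra) pure_tensor \<Rightarrow>\<^sub>0 complex) set" where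
  "tensor_null = module.span free_scale bilinearity_relations"

lemma free_pure_mult: "free_pure a b * free_pure a' b' = free_pure (a * a') (b * b')"
  by (simp add: free_pure_def mult_single)

lemma bilinearity_relations_cases:
  assumes "x \<in> bilinearity_relations"
  obtains a a' b where "x = free_pure (a + a') b - free_pure a b - free_pure a' b"
  | a b b' where "x = free_pure a (b + b') - free_pure a b - free_pure a b'"
  | c a b where "x = free_pure (c *\<^sub>C a) b - free_scale c (free_pure a b)"
  | c a b where "x = free_pure a (c *\<^sub>C b) - free_scale c (free_pure a b)"
  using assms unfolding bilinearity_relations_def by blast

lemma bilinearity_relations_intros:
  "free_pure (a + a') b - free_pure a b - free_pure a' b \<in> bilinearity_relations"
  "free_pure a (b + b') - free_pure a b - free_pure a b' \<in> bilinearity_relations"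
  "free_pure (c *\<^sub>C a) b - free_scale c (free_pure a b) \<in> bilinearity_relations"
  "free_pure a (c *\<^sub>C b) - free_scale c (free_pure a b) \<in> bilinearity_relations"
  unfolding bilinearity_relations_def by blast+

lemma bilinearity_relations_mult:
  assumes "x \<in> bilinearity_relations"
  shows "free_pure a b * x \<in> bilinearity_relations" "x * free_pure a b \<in> bilinearity_relations"
  using assms
  by (cases rule: bilinearity_relations_cases;
      simp add: left_diff_distrib right_diff_distrib distrib_left distrib_right free_pure_mult
        free_scale_mult_left free_scale_mult_right mult_scaleC_left mult_scaleC_right
        bilinearity_relations_intros)+

lemma two_sided_ideal_tensor_null: "two_sided_ideal tensor_null"
proof -
  interpret module "free_scale :: complex \<Rightarrow> (('a, 'b) pure_tensor \<Rightarrow>\<^sub>0 complex) \<Rightarrow> _"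
    by (rule module_free_scale)
  have pure: "free_pure a b * x \<in> tensor_null \<and> x * free_pure a b \<in> tensor_null"
    if "x \<in> tensor_null" for a b and x :: "('a, 'b) pure_tensor \<Rightarrow>\<^sub>0 complex"
    using that unfolding tensor_null_def
  proof (induction rule: span_induct_alt)
    case base
    then show ?case by (simp add: span_zero)
  next
    case (step c x y)
    then show ?case
      by (simp add: distrib_left distrib_right free_scale_mult_left free_scale_mult_right
          span_add span_scale span_base bilinearity_relations_mult)
  qed
  have "r * x \<in> tensor_null \<and> x * r \<in> tensor_null"
    if x: "x \<in> tensor_null" for r x :: "('a, 'b) pure_tensor \<Rightarrow>\<^sub>0 complex"
  proof (induction r rule: poly_mapping_single_induct)
    case (single w c)
    obtain a b where w: "w = Pure a b" by (cases w)
    have "Poly_Mapping.single w c = free_scale c (free_pure a b)"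
      by (simp add: w free_pure_def free_scale_mult mult_single)
    then show ?case
      using pure[OF x, of a b]
      by (simp add: free_scale_mult_left free_scale_mult_right tensor_null_def span_scale)
  next
    case (add r r')
    then show ?case
      by (simp add: distrib_left distrib_right tensor_null_def span_add)
  qed
  then show ?thesis
    unfolding two_sided_ideal_def by (auto simp: tensor_null_def span_zero span_add)
qed

quotient_type (overloaded) ('a, 'b) tensor = "('a::complex_algebra, 'b::complex_algebra) pure_tensor \<Rightarrow>\<^sub>0 complex"
  / "\<lambda>x y. x - y \<in> tensor_null"
  by (rule ideal_equivp[OF two_sided_ideal_tensor_null])

instantiation tensor :: (complex_algebra, complex_algebra) complex_algebra
begin
lift_definition zero_tensor :: "('a, 'b) tensor" is 0 .
lift_definition one_tensor :: "('a, 'b) tensor" is 1 .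
lift_definition plus_tensor :: "('a, 'b) tensor \<Rightarrow> ('a, 'b) tensor \<Rightarrow> ('a, 'b) tensor" is "(+)"
  by (rule ideal_cong_add[OF two_sided_ideal_tensor_null])
lift_definition minus_tensor :: "('a, 'b) tensor \<Rightarrow> ('a, 'b) tensor \<Rightarrow> ('a, 'b) tensor" is "(-)"
  by (rule ideal_cong_diff[OF two_sided_ideal_tensor_null])
lift_definition uminus_tensor :: "('a, 'b) tensor \<Rightarrow> ('a, 'b) tensor" is uminus
  by (rule ideal_cong_uminus[OF two_sided_ideal_tensor_null])
lift_definition times_tensor :: "('a, 'b) tensor \<Rightarrow> ('a, 'b) tensor \<Rightarrow> ('a, 'b) tensor" is "(*)"
  by (rule ideal_cong_mult[OF two_sided_ideal_tensor_null])
lift_definition scaleC_tensor :: "complex \<Rightarrow> ('a, 'b) tensor \<Rightarrow> ('a, 'b) tensor" is free_scale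
  by (rule ideal_cong_scale[OF two_sided_ideal_tensor_null])
instance
proof
  fix x y z :: "('a, 'b) tensor" and c d :: complex
  show "x + y + z = x + (y + z)"
    by (transfer, rule ideal_cong_refl[OF two_sided_ideal_tensor_null], rule add.assoc)
  show "x + y = y + x"
    by (transfer, rule ideal_cong_refl[OF two_sided_ideal_tensor_null], rule add.commute)
  show "0 + x = x"
    by (transfer, rule ideal_cong_refl[OF two_sided_ideal_tensor_null], rule add_0)
  show "- x + x = 0"
    by (transfer, rule ideal_cong_refl[OF two_sided_ideal_tensor_null], rule left_minus)
  show "x - y = x + - y"
    by (transfer, rule ideal_cong_refl[OF two_sided_ideal_tensor_null], rule diff_conv_add_uminus)
  show "x * y * z = x * (y * z)"
    by (transfer, rule ideal_cong_refl[OF two_sided_ideal_tensor_null], rule mult.assoc)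
  show "1 * x = x"
    by (transfer, rule ideal_cong_refl[OF two_sided_ideal_tensor_null], rule mult_1_left)
  show "x * 1 = x"
    by (transfer, rule ideal_cong_refl[OF two_sided_ideal_tensor_null], rule mult_1_right)
  show "(x + y) * z = x * z + y * z"
    by (transfer, rule ideal_cong_refl[OF two_sided_ideal_tensor_null], rule distrib_right)
  show "x * (y + z) = x * y + x * z"
    by (transfer, rule ideal_cong_refl[OF two_sided_ideal_tensor_null], rule distrib_left)
  show "c *\<^sub>C (x + y) = c *\<^sub>C x + c *\<^sub>C y"
    by (transfer, rule ideal_cong_refl[OF two_sided_ideal_tensor_null], rule free_scale_simps)
  show "(c + d) *\<^sub>C x = c *\<^sub>C x + d *\<^sub>C x"
    by (transfer, rule ideal_cong_refl[OF two_sided_ideal_tensor_null], rule free_scale_simps)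
  show "c *\<^sub>C d *\<^sub>C x = (c * d) *\<^sub>C x"
    by (transfer, rule ideal_cong_refl[OF two_sided_ideal_tensor_null], rule free_scale_simps)
  show "1 *\<^sub>C x = x"
    by (transfer, rule ideal_cong_refl[OF two_sided_ideal_tensor_null], rule free_scale_simps)
  show "(c *\<^sub>C x) * y = c *\<^sub>C (x * y)"
    by (transfer, rule ideal_cong_refl[OF two_sided_ideal_tensor_null], rule free_scale_mult_left)
  show "x * (c *\<^sub>C y) = c *\<^sub>C (x * y)"
    by (transfer, rule ideal_cong_refl[OF two_sided_ideal_tensor_null], rule free_scale_mult_right)
qed
end

lift_definition tensor_of ::
    "'a::complex_algebra \<Rightarrow> 'b::complex_algebra \<Rightarrow> ('a, 'b) tensor"  (infixl \<open>\<otimes>\<^sub>C\<close> 78) is free_pure .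

text \<open>Over a field, the tensor product of subspaces \<open>A\<close>, \<open>B\<close> embeds into the tensor product of the
  ambient spaces, with image the span of the \<open>a \<otimes> b\<close>; we identify it with this image.\<close>

definition tensor_sub :: "'a::complex_algebra set \<Rightarrow> 'b::complex_algebra set \<Rightarrow> ('a, 'b) tensor set" where
  "tensor_sub A B = module.span scaleC {a \<otimes>\<^sub>C b | a b. a \<in> A \<and> b \<in> B}"

end

(* Let U(gl_3) act on C[z_1, z_-1] x_0^e with e = e_{0,0} a formal exponent. The comultiplication
   of Y_3, followed by the evaluation T_{i,j}(u) -> delta_{i,j} + e_{i,j} / (u - 2) on the second
   factor, makes Y_3 act on R[z_1, z_-1] with R = Y_3 (x) U(gl_1). On the constants R the series
   D_{i,j}(u) acts as D_{i,j}(u) (x) 1, G(u) as G(u) (1 + e/u) (1 - e/(u+2)), and E_i(u) as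
   E_i(u) (1 + e/u) + z_i e/u. Only E_i^(1) moves the constants, so Y_3^+(k) with k > 0 preserves
   R and acts on it by left multiplications; this yields phi_k with no need for a presentation of
   Y_3^+(k). The counit of U(gl_1) is a left inverse of phi_k. *)
theory Submission
  imports Defs
begin

section \<open>Homomorphisms out of quotients of free algebras\<close>

text \<open>The obstacle is the inverse matrix in the definition of \<open>E\<close>: its action
  away from the constants is complicated. It is never computed. \<open>E\<close> solves the linear
  system \<open>D E = S_{.,0}\<close>; the proposed action of \<open>E\<close> on constants is
  checked against this system, and the image of \<open>D^-1\<close> is applied afterwards from the
  left. Equality on constants survives only multiplication from the left. Since \<open>E_i\<close>
  creates the linear monomial \<open>z_i\<close>, the entries \<open>S_{i,j}\<close> have to be
  evaluated on linear monomials as well.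

  The 2 in \<open>u - 2\<close> is the number of oscillators. For \<open>p = 1/(u-a)\<close> the
  system asks for a series \<open>c\<close> with \<open>(1 + 2 p) c = p e\<close>, that is
  \<open>c = e/(u-a+2)\<close>. The two terms of the image of \<open>E_i^(m)\<close> demand
  \<open>c = e/u\<close>, hence \<open>a = 2\<close>. The substitution \<open>u -> -u\<close> in
  \<eta> turns this pole into \<open>1/(u+2)\<close>, whose coefficients are the powers of -2 in the
  formula for \<open>G\<close>.\<close>

lemma scaleC_zero_right: "c *\<^sub>C (0 :: 'a::complex_algebra) = 0"
  using scaleC_add_right[of c 0 "0::'a"] by simp

lemma scaleC_minus_right: "c *\<^sub>C (- x) = - (c *\<^sub>C (x :: 'a::complex_algebra))"
  using scaleC_add_right[of c x "-x"] by (simp add: scaleC_zero_right eq_neg_iff_add_eq_0 add.commute)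

lemma scaleC_diff_right: "c *\<^sub>C (x - y) = c *\<^sub>C x - c *\<^sub>C (y :: 'a::complex_algebra)"
  using scaleC_add_right[of c x "-y"] by (simp add: scaleC_minus_right)

lemma scaleC_sum_right: "c *\<^sub>C (\<Sum>i\<in>I. f i) = (\<Sum>i\<in>I. c *\<^sub>C (f i :: 'a::complex_algebra))"
  by (induction I rule: infinite_finite_induct) (simp_all add: scaleC_zero_right scaleC_add_right)

text \<open>The key type is arbitrary: words give maps out of the Yangian, pure tensors give maps
  out of a tensor product.\<close>

definition linear_extension :: "('m \<Rightarrow> 'a::complex_algebra) \<Rightarrow> ('m \<Rightarrow>\<^sub>0 complex) \<Rightarrow> 'a" where
  "linear_extension f p = (\<Sum>w\<in>Poly_Mapping.keys p. Poly_Mapping.lookup p w *\<^sub>C f w)"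

lemma linear_extension_superset:
  assumes "finite A" "Poly_Mapping.keys p \<subseteq> A"
  shows "linear_extension f p = (\<Sum>w\<in>A. Poly_Mapping.lookup p w *\<^sub>C f w)"
  unfolding linear_extension_def
  by (rule sum.mono_neutral_left) (use assms in \<open>auto simp: in_keys_iff scaleC_zero_left\<close>)

lemma linear_extension_single: "linear_extension f (Poly_Mapping.single w c) = c *\<^sub>C f w"
  by (subst linear_extension_superset[of "{w}"]) auto

lemma linear_extension_add: "linear_extension f (p + q) = linear_extension f p + linear_extension f q"
proof -
  let ?A = "Poly_Mapping.keys p \<union> Poly_Mapping.keys q"
  show ?thesis
    using Poly_Mapping.keys_add[of p q]
    by (simp add: linear_extension_superset[of ?A] lookup_add scaleC_add_left sum.distrib)
qed

lemma linear_extension_zero: "linear_extension f 0 = 0"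
  by (simp add: linear_extension_def)

lemma linear_extension_uminus: "linear_extension f (- p) = - linear_extension f p"
  using linear_extension_add[of f p "-p"] by (simp add: linear_extension_zero eq_neg_iff_add_eq_0 add.commute)

lemma linear_extension_diff: "linear_extension f (p - q) = linear_extension f p - linear_extension f q"
  using linear_extension_add[of f p "-q"] by (simp add: linear_extension_uminus)

lemma linear_extension_sum: "linear_extension f (\<Sum>i\<in>I. p i) = (\<Sum>i\<in>I. linear_extension f (p i))"
  by (induction I rule: infinite_finite_induct) (simp_all add: linear_extension_zero linear_extension_add)

lemma linear_extension_scale: "linear_extension f (free_scale c p) = c *\<^sub>C linear_extension f p"
  by (subst linear_extension_superset[of "Poly_Mapping.keys p"])
    (auto simp: in_keys_iff lookup_free_scale linear_extension_def scaleC_sum_right scaleC_scaleC)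

lemma linear_extension_mult:
  fixes f :: "'m::monoid_add \<Rightarrow> 'a::complex_algebra"
  assumes f: "\<And>v w. f (v + w) = f v * f w"
  shows "linear_extension f (p * q) = linear_extension f p * linear_extension f q"
proof (induction p rule: poly_mapping_single_induct)
  case (single w c)
  show ?case
    by (induction q rule: poly_mapping_single_induct)
      (simp_all add: mult_single linear_extension_single linear_extension_add f mult_scaleC_left
        mult_scaleC_right scaleC_scaleC distrib_left mult.commute)
qed (simp add: linear_extension_add distrib_right)

fun word_prod :: "('g \<Rightarrow> 'a::monoid_mult) \<Rightarrow> 'g free_word \<Rightarrow> 'a" where
  "word_prod g (Word w) = prod_list (map g w)"

lemma word_prod_add: "word_prod g (v + w) = word_prod g v * word_prod g w"
  by (cases v; cases w) simp

lemma word_prod_zero: "word_prod g 0 = 1"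
  by (simp add: zero_free_word_def)

lemma linear_extension_one: "f 0 = 1 \<Longrightarrow> linear_extension f 1 = 1"
  using linear_extension_single[of f 0 1] by (simp add: single_one scaleC_one)

definition alg_hom :: "('a::complex_algebra \<Rightarrow> 'b::complex_algebra) \<Rightarrow> bool" where
  "alg_hom f \<longleftrightarrow> alg_hom_on UNIV f"

lemma alg_homI:
  assumes "f 1 = 1" "\<And>x y. f (x + y) = f x + f y" "\<And>x y. f (x * y) = f x * f y"
    "\<And>c x. f (c *\<^sub>C x) = c *\<^sub>C f x"
  shows "alg_hom f"
  using assms by (auto simp: alg_hom_def alg_hom_on_def)

lemma
  assumes "alg_hom f"
  shows alg_hom_one: "f 1 = 1"
    and alg_hom_add: "f (x + y) = f x + f y"
    and alg_hom_mult: "f (x * y) = f x * f y"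
    and alg_hom_scaleC: "f (c *\<^sub>C x) = c *\<^sub>C f x"
    and alg_hom_zero: "f 0 = 0"
    and alg_hom_uminus: "f (- x) = - f x"
    and alg_hom_diff: "f (x - y) = f x - f y"
    and alg_hom_sum: "f (\<Sum>i\<in>I. g i) = (\<Sum>i\<in>I. f (g i))"
proof -
  show 1: "f 1 = 1" and add: "f (x + y) = f x + f y" and "f (x * y) = f x * f y"
    and scale: "f (c *\<^sub>C x) = c *\<^sub>C f x" for x y c
    using assms by (auto simp: alg_hom_def alg_hom_on_def)
  show zero: "f 0 = 0"
    using scale[of 0 0] by (simp add: scaleC_zero_left)
  show uminus: "f (- x) = - f x" for x
    using add[of x "- x"] by (simp add: zero eq_neg_iff_add_eq_0 add.commute)
  show "f (x - y) = f x - f y"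
    using add[of x "- y"] by (simp add: uminus)
  show "f (\<Sum>i\<in>I. g i) = (\<Sum>i\<in>I. f (g i))"
    by (induction I rule: infinite_finite_induct) (simp_all add: zero add)
qed

section \<open>Algebra homomorphisms out of the Yangian\<close>

lemma abs_y3_simps:
  "1 = abs_y3 1" "0 = abs_y3 0" "abs_y3 p + abs_y3 q = abs_y3 (p + q)"
  "abs_y3 p * abs_y3 q = abs_y3 (p * q)" "c *\<^sub>C abs_y3 p = abs_y3 (free_scale c p)"
  by (simp_all add: one_y3_def zero_y3_def plus_y3.abs_eq times_y3.abs_eq scaleC_y3.abs_eq)

text \<open>The universal property of the presentation: the kernel of the induced map on the free
  algebra is a two-sided ideal, so it contains the whole ideal as soon as it contains the relations.
  The degree 0 coefficients belong to the data because the relations mention them.\<close>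

lemma y3_hom_exists:
  fixes t :: "3 \<Rightarrow> 3 \<Rightarrow> nat \<Rightarrow> 'a::{ring_1,complex_algebra}"
  assumes t0: "\<And>i j. t i j 0 = (if i = j then 1 else 0)"
    and rel: "\<And>i j k l r s. t i j r * t k l s - t k l s * t i j r
      = (\<Sum>a<r. t k j (r - 1 - a) * t i l (s + a) - t k j (s + a) * t i l (r - 1 - a))"
  shows "\<exists>\<rho>. alg_hom \<rho> \<and> (\<forall>i j r. \<rho> (y3_T_coeff i j r) = t i j r)"
proof -
  define f where "f = word_prod (\<lambda>(i, j, r). t i j (Suc r))"
  define F where "F = linear_extension f"
  have f0: "f 0 = 1" and f_add: "f (v + w) = f v * f w" for v w
    by (simp_all add: f_def word_prod_zero word_prod_add)
  have mult: "F (p * q) = F p * F q" for p q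
    unfolding F_def by (rule linear_extension_mult) (rule f_add)
  have one: "F 1 = 1"
    unfolding F_def by (rule linear_extension_one) (rule f0)
  have zero: "F 0 = 0"
    by (simp add: F_def linear_extension_zero)
  have diff: "F (p - q) = F p - F q" for p q
    by (simp add: F_def linear_extension_diff)
  have sum: "F (\<Sum>i\<in>I. p i) = (\<Sum>i\<in>I. F (p i))" for p and I :: "nat set"
    by (simp add: F_def linear_extension_sum)
  have T: "F (free_T i j r) = t i j r" for i j r
    by (cases r) (auto simp: one zero t0, simp add: F_def free_gen_def linear_extension_single f_def scaleC_one)
  have ker: "two_sided_ideal hull y3_relations \<subseteq> {p. F p = 0}"
  proof (rule hull_minimal)
    show "two_sided_ideal {p. F p = 0}"
      by (auto simp: two_sided_ideal_def mult zero) (simp add: F_def linear_extension_add)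
    show "y3_relations \<subseteq> {p. F p = 0}"
      by (auto simp: y3_relations_def diff sum mult T rel)
  qed
  define \<rho> where "\<rho> x = F (rep_y3 x)" for x
  have \<rho>: "\<rho> (abs_y3 p) = F p" for p
  proof -
    have "rep_y3 (abs_y3 p) - p \<in> two_sided_ideal hull y3_relations"
      using Quotient3_abs_rep[OF Quotient3_y3, of "abs_y3 p"] by (simp add: y3.abs_eq_iff)
    then have "F (rep_y3 (abs_y3 p) - p) = 0"
      using ker by blast
    then show ?thesis by (simp add: \<rho>_def F_def linear_extension_diff)
  qed
  have "alg_hom \<rho>"
  proof (rule alg_homI)
    show "\<rho> 1 = 1"
      by (simp add: abs_y3_simps \<rho> one)
    fix x y c
    obtain p q where pq: "x = abs_y3 p" "y = abs_y3 q"
      by (metis Quotient3_abs_rep[OF Quotient3_y3])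
    show "\<rho> (x + y) = \<rho> x + \<rho> y" "\<rho> (x * y) = \<rho> x * \<rho> y" "\<rho> (c *\<^sub>C x) = c *\<^sub>C \<rho> x"
      unfolding pq abs_y3_simps \<rho> mult by (simp_all add: F_def linear_extension_add linear_extension_scale)
  qed
  moreover have "\<rho> (y3_T_coeff i j r) = t i j r" for i j r
    by (simp add: y3_T_coeff.abs_eq \<rho> T)
  ultimately show ?thesis by blast
qed

section \<open>The counit of the enveloping algebra and its extension to tensor products\<close>

lemma lookup_free_gen_zero: "Poly_Mapping.lookup (free_gen g) 0 = 0"
  by (simp add: free_gen_def zero_free_word_def lookup_single when_def)

text \<open>The counit reads off the coefficient of the empty word. It descends to the quotient
  because no defining relation has a constant term.\<close>

lift_definition ugl_counit :: "('n::finite) ugl \<Rightarrow> complex" is "\<lambda>p. Poly_Mapping.lookup p 0"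
proof -
  have "two_sided_ideal hull ugl_relations \<subseteq> {p :: (complex ^ 'n ^ 'n) free_algebra. Poly_Mapping.lookup p 0 = 0}"
    by (rule hull_minimal)
      (auto simp: two_sided_ideal_def ugl_relations_def lookup_mult_zero lookup_add lookup_minus
        lookup_free_scale lookup_free_gen_zero)
  then show "Poly_Mapping.lookup p 0 = Poly_Mapping.lookup q 0"
    if "p - q \<in> two_sided_ideal hull ugl_relations" for p q :: "(complex ^ 'n ^ 'n) free_algebra"
    using that by (auto simp: lookup_minus)
qed

lemma ugl_counit_one: "ugl_counit 1 = 1"
  by transfer (simp add: lookup_one)

lemma ugl_counit_add: "ugl_counit (x + y) = ugl_counit x + ugl_counit y"
  by transfer (simp add: lookup_add)

lemma ugl_counit_scaleC: "ugl_counit (c *\<^sub>C x) = c * ugl_counit x"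
  by transfer (simp add: lookup_free_scale)

lemma ugl_counit_mult: "ugl_counit (x * y) = ugl_counit x * ugl_counit y"
  by transfer (simp add: lookup_mult_zero)

lemma ugl_counit_e: "ugl_counit (ugl_e i j) = 0"
  unfolding ugl_e_def by transfer (rule lookup_free_gen_zero)

fun pure_counit :: "('a::complex_algebra, ('n::finite) ugl) pure_tensor \<Rightarrow> 'a" where
  "pure_counit (Pure a b) = ugl_counit b *\<^sub>C a"

text \<open>The map \<open>id (x) counit\<close>. It later recovers \<open>P\<close> from its image,
  which gives injectivity, and it also shows that the coefficient ring of the oscillator module is
  not zero.\<close>

lift_definition tensor_counit :: "('a::complex_algebra, ('n::finite) ugl) tensor \<Rightarrow> 'a"
  is "linear_extension pure_counit"
proof -
  interpret module "free_scale :: complex \<Rightarrow> (('a, 'n ugl) pure_tensor \<Rightarrow>\<^sub>0 complex) \<Rightarrow> _"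
    by (rule module_free_scale)
  have "linear_extension pure_counit x = 0" if "x \<in> tensor_null"
    for x :: "('a, 'n ugl) pure_tensor \<Rightarrow>\<^sub>0 complex"
    using that unfolding tensor_null_def
  proof (induction rule: span_induct_alt)
    case (step c x y)
    from step(1) have "linear_extension pure_counit x = 0"
      by (cases rule: bilinearity_relations_cases)
        (simp_all add: linear_extension_diff linear_extension_scale free_pure_def
          linear_extension_single ugl_counit_add ugl_counit_scaleC scaleC_add_left scaleC_add_right
          scaleC_one scaleC_scaleC mult.commute)
    with step show ?case
      by (simp add: linear_extension_add linear_extension_scale scaleC_zero_right)
  qed (simp add: linear_extension_zero)
  then show "linear_extension pure_counit p = linear_extension pure_counit q"
    if "p - q \<in> tensor_null" for p q :: "('a, 'n ugl) pure_tensor \<Rightarrow>\<^sub>0 complex"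
    using that by (metis linear_extension_diff right_minus_eq)
qed

lemma tensor_counit_pure: "tensor_counit (a \<otimes>\<^sub>C b) = ugl_counit b *\<^sub>C a"
  by transfer (simp add: free_pure_def linear_extension_single scaleC_one)

lemma alg_hom_tensor_counit: "alg_hom (tensor_counit :: ('a::complex_algebra, ('n::finite) ugl) tensor \<Rightarrow> 'a)"
proof (rule alg_homI)
  have [simp]: "pure_counit (v + w) = pure_counit v * pure_counit w" for v w :: "('a, 'n ugl) pure_tensor"
    by (cases v; cases w)
      (simp add: ugl_counit_mult mult_scaleC_left mult_scaleC_right scaleC_scaleC mult.commute)
  show "tensor_counit (1 :: ('a, 'n ugl) tensor) = 1"
    by transfer (rule linear_extension_one, simp add: zero_pure_tensor_def ugl_counit_one scaleC_one)
  show "tensor_counit (x + y) = tensor_counit x + tensor_counit y" 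
       "tensor_counit (x * y) = tensor_counit x * tensor_counit y" 
       "tensor_counit (c *\<^sub>C x) = c *\<^sub>C tensor_counit x" for x y :: "('a, 'n ugl) tensor" and c
    by (transfer, simp add: linear_extension_add linear_extension_mult linear_extension_scale)+
qed

section \<open>Calculus with pure tensors\<close>

lemma tensor_of_mult: "(a \<otimes>\<^sub>C b) * (a' \<otimes>\<^sub>C b') = (a * a') \<otimes>\<^sub>C (b * b')"
  by (transfer, rule ideal_cong_refl[OF two_sided_ideal_tensor_null], rule free_pure_mult)

lemma free_pure_one: "free_pure 1 1 = 1"
  unfolding free_pure_def zero_pure_tensor_def[symmetric] by (rule single_one)

lemma tensor_of_one: "1 \<otimes>\<^sub>C 1 = 1"
  by (transfer, rule ideal_cong_refl[OF two_sided_ideal_tensor_null], rule free_pure_one)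

lemma span_bilinearity: "x \<in> bilinearity_relations \<Longrightarrow> x \<in> tensor_null"
  unfolding tensor_null_def by (rule module.span_base[OF module_free_scale])

lemma tensor_of_add_left: "(a + a') \<otimes>\<^sub>C b = a \<otimes>\<^sub>C b + a' \<otimes>\<^sub>C b"
  by transfer (metis span_bilinearity bilinearity_relations_intros(1) diff_diff_eq)

lemma tensor_of_scaleC_left: "(c *\<^sub>C a) \<otimes>\<^sub>C b = c *\<^sub>C (a \<otimes>\<^sub>C b)"
  by transfer (metis span_bilinearity bilinearity_relations_intros(3))

lemma alg_hom_tensor_left: "alg_hom (\<lambda>a :: 'a::complex_algebra. a \<otimes>\<^sub>C (1 :: 'b::complex_algebra))"
  by (rule alg_homI) (simp_all add: tensor_of_one tensor_of_add_left tensor_of_mult tensor_of_scaleC_left)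

lemma subalgebra_tensor_sub:
  assumes A: "subalgebra A"
  shows "subalgebra (tensor_sub A (UNIV :: 'b::complex_algebra set))"
proof -
  interpret module "scaleC :: complex \<Rightarrow> ('a, 'b) tensor \<Rightarrow> _"
    by unfold_locales (simp_all add: scaleC_add_right scaleC_add_left scaleC_scaleC scaleC_one)
  let ?P = "{a \<otimes>\<^sub>C b | a (b :: 'b). a \<in> A \<and> b \<in> UNIV}"
  have mult1: "p * y \<in> span ?P" if "p \<in> ?P" "y \<in> span ?P" for p y
    using that(2)
  proof (induction rule: span_induct_alt)
    case (step c x y)
    from \<open>p \<in> ?P\<close> \<open>x \<in> ?P\<close> have "p * x \<in> ?P"
      using subalgebra_mult[OF A] by (fastforce simp: tensor_of_mult)
    with step show ?case
      by (simp add: distrib_left mult_scaleC_right span_add span_scale span_base)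
  qed (simp add: span_zero)
  have "x * y \<in> span ?P" if "x \<in> span ?P" "y \<in> span ?P" for x y
    using that(1)
  proof (induction rule: span_induct_alt)
    case (step c p x)
    with mult1[OF step(1) that(2)] show ?case
      by (simp add: distrib_right mult_scaleC_left span_add span_scale)
  qed (simp add: span_zero)
  moreover have "1 \<in> span ?P"
    by (rule span_base) (auto simp: tensor_of_one[symmetric] intro: subalgebra_one[OF A])
  ultimately show ?thesis
    by (auto simp: subalgebra_def tensor_sub_def intro: span_add span_scale)
qed

lemma tensor_of_in_tensor_sub: "a \<in> A \<Longrightarrow> a \<otimes>\<^sub>C b \<in> tensor_sub A UNIV"
proof -
  interpret module "scaleC :: complex \<Rightarrow> ('a, 'b) tensor \<Rightarrow> _"
    by unfold_locales (simp_all add: scaleC_add_right scaleC_add_left scaleC_scaleC scaleC_one)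
  show "a \<in> A \<Longrightarrow> a \<otimes>\<^sub>C b \<in> tensor_sub A UNIV"
    unfolding tensor_sub_def by (rule span_base) auto
qed

section \<open>The oscillator module\<close>

text \<open>A function \<open>f\<close> on multi-indices stands for the power series in \<open>z\<^sub>1\<close> and \<open>z\<^sub>-\<^sub>1\<close> in which \<open>f m\<close> is the
  coefficient of the monomial with exponents \<open>m 1\<close> and \<open>m (-1)\<close>. The index type is \<^typ>\<open>3\<close>, and the
  irrelevant entry \<open>m 0\<close> is not removed: the operators below leave it alone.\<close>

type_synonym osc_coeff = "(y3, 1 ugl) tensor"
type_synonym osc_module = "(3 \<Rightarrow> nat) \<Rightarrow> osc_coeff"

text \<open>Linearity is built into the type because composition of arbitrary functions distributes
  over sums on one side only. The operators are linear over the complex numbers, not over the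
  noncommutative coefficients.\<close>

typedef osc_op = "{f :: osc_module \<Rightarrow> osc_module.
    (\<forall>x y. f (\<lambda>m. x m + y m) = (\<lambda>m. f x m + f y m)) \<and> (\<forall>c x. f (\<lambda>m. c *\<^sub>C x m) = (\<lambda>m. c *\<^sub>C f x m))}"
  morphisms osc_apply Abs_osc_op
  by (rule exI[of _ id]) simp

lifting_forget tensor.lifting
lifting_forget y3.lifting
lifting_forget ugl.lifting
setup_lifting type_definition_osc_op

text \<open>The counit of the second factor maps 1 to the unit of \<open>Y_3\<close>, which is not
  0. The class \<open>ring_1\<close> asks for this on operators.\<close>

lemma one_neq_zero_osc_coeff: "(1 :: osc_coeff) \<noteq> 0"
proof
  assume "(1 :: osc_coeff) = 0"
  then have "tensor_counit (1 :: osc_coeff) = tensor_counit (0 :: osc_coeff)"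
    by simp
  then show False
    by (simp add: alg_hom_one[OF alg_hom_tensor_counit] alg_hom_zero[OF alg_hom_tensor_counit])
qed

instantiation osc_op :: "{ring_1, complex_algebra}"
begin
lift_definition zero_osc_op :: osc_op is "\<lambda>f m. 0" by (simp add: scaleC_zero_right)
lift_definition one_osc_op :: osc_op is "\<lambda>f. f" by simp
lift_definition plus_osc_op :: "osc_op \<Rightarrow> osc_op \<Rightarrow> osc_op" is "\<lambda>a b f m. a f m + b f m"
  by (simp add: scaleC_add_right algebra_simps)
lift_definition minus_osc_op :: "osc_op \<Rightarrow> osc_op \<Rightarrow> osc_op" is "\<lambda>a b f m. a f m - b f m"
  by (simp add: scaleC_diff_right algebra_simps)
lift_definition uminus_osc_op :: "osc_op \<Rightarrow> osc_op" is "\<lambda>a f m. - a f m"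
  by (simp add: scaleC_minus_right)
lift_definition times_osc_op :: "osc_op \<Rightarrow> osc_op \<Rightarrow> osc_op" is "\<lambda>a b f. a (b f)"
  by simp
lift_definition scaleC_osc_op :: "complex \<Rightarrow> osc_op \<Rightarrow> osc_op" is "\<lambda>c a f m. c *\<^sub>C a f m"
  by (simp add: scaleC_add_right scaleC_scaleC mult.commute)
instance
proof
  fix a b c :: osc_op and s t :: complex
  show "a * (b + c) = a * b + a * c" "(a + b) * c = a * c + b * c" "a * b * c = a * (b * c)"
    "a + b + c = a + (b + c)" "a + b = b + a" "0 + a = a" "- a + a = 0" "a - b = a + - b"
    "1 * a = a" "a * 1 = a"
    by (transfer; simp add: algebra_simps)+
  show "s *\<^sub>C (a + b) = s *\<^sub>C a + s *\<^sub>C b" "(s + t) *\<^sub>C a = s *\<^sub>C a + t *\<^sub>C a"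
    "s *\<^sub>C t *\<^sub>C a = (s * t) *\<^sub>C a" "1 *\<^sub>C a = a" "s *\<^sub>C a * b = s *\<^sub>C (a * b)"
    "a * s *\<^sub>C b = s *\<^sub>C (a * b)"
    by (transfer; simp add: scaleC_add_left scaleC_add_right scaleC_scaleC scaleC_one)+
  show "(0 :: osc_op) \<noteq> 1"
    by transfer (use one_neq_zero_osc_coeff in \<open>metis\<close>)
qed
end

section \<open>Oscillators and the matrix units of gl_3\<close>

definition osc_e :: osc_coeff where
  "osc_e = 1 \<otimes>\<^sub>C ugl_e 0 0"

lift_definition osc_coef :: "osc_coeff \<Rightarrow> osc_op" is "\<lambda>r f m. r * f m"
  by (simp add: distrib_left mult_scaleC_right)

definition osc_degree :: "(3 \<Rightarrow> nat) \<Rightarrow> nat" where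
  "osc_degree m = m 1 + m (-1)"

lemma index_3_cases: "(i :: 3) = -1 \<or> i = 0 \<or> i = 1"
  using UNIV_3 by auto

lemma osc_degree_Suc: "j \<noteq> 0 \<Longrightarrow> osc_degree (m(j := Suc (m j))) = Suc (osc_degree m)"
  using index_3_cases[of j] minus_one_neq_one_3 by (auto simp: osc_degree_def)

lemma osc_degree_pred: "j \<noteq> 0 \<Longrightarrow> m j \<noteq> 0 \<Longrightarrow> osc_degree m = Suc (osc_degree (m(j := m j - 1)))"
  using osc_degree_Suc[of j "m(j := m j - 1)"] by simp

text \<open>In homogeneous coordinates \<open>z_i = x_i / x_0\<close>, so index 0 gives the
  identity. For the other indices the coefficient at \<open>m\<close> comes from the monomial with
  one factor \<open>z_i\<close> fewer.\<close>

lift_definition osc_z :: "3 \<Rightarrow> osc_op" is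
  "\<lambda>i f m. if i = 0 then f m else if m i = 0 then 0 else f (m(i := m i - 1))"
  by (auto simp: scaleC_zero_right fun_eq_iff)

text \<open>\<open>osc_d 0\<close> is differentiation by \<open>x\<^sub>0\<close>, multiplied by \<open>x\<^sub>0\<close>: the operator \<open>e - z\<^sub>1 \<partial>\<^sub>1 - z\<^sub>-\<^sub>1 \<partial>\<^sub>-\<^sub>1\<close>.
  With \<open>z\<^sub>0 = 1\<close>, the operators \<open>osc_z i * osc_d j\<close> satisfy the relations of the matrix units \<open>e\<^sub>i\<^sub>j\<close>.\<close>

lift_definition osc_d :: "3 \<Rightarrow> osc_op" is
  "\<lambda>j f m. if j = 0 then osc_e * f m - of_nat (osc_degree m) *\<^sub>C f m
    else of_nat (Suc (m j)) *\<^sub>C f (m(j := Suc (m j)))"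
  by (auto simp: distrib_left mult_scaleC_right scaleC_add_right scaleC_diff_right scaleC_scaleC
      fun_eq_iff mult.commute)

lemma osc_z_0: "osc_z 0 = 1"
  by transfer simp

lemma osc_z_commute: "osc_z i * osc_z k = osc_z k * osc_z i"
  by transfer (auto simp: fun_eq_iff fun_upd_twist)

lemma osc_coef_z: "osc_z i * osc_coef r = osc_coef r * osc_z i"
  by transfer (auto simp: fun_eq_iff)

lemma osc_coef_d: "r * osc_e = osc_e * r \<Longrightarrow> osc_d j * osc_coef r = osc_coef r * osc_d j"
  by transfer (auto simp: fun_eq_iff right_diff_distrib mult_scaleC_right simp flip: mult.assoc)

lemma scaleC_of_nat_Suc: "of_nat (Suc n) *\<^sub>C x = x + of_nat n *\<^sub>C (x :: 'a::complex_algebra)"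
  by (simp add: scaleC_add_left scaleC_one)

lemma scaleC_diff_left: "(c - d) *\<^sub>C x = c *\<^sub>C x - d *\<^sub>C (x :: 'a::complex_algebra)"
  using scaleC_add_left[of "c - d" d x] by simp

lemma osc_eqI: "(\<And>f m. osc_apply a f m = osc_apply b f m) \<Longrightarrow> a = b"
  by (simp add: osc_apply_inject[symmetric] fun_eq_iff)

lemmas osc_apply_simps = plus_osc_op.rep_eq minus_osc_op.rep_eq times_osc_op.rep_eq
  one_osc_op.rep_eq zero_osc_op.rep_eq osc_coef.rep_eq osc_z.rep_eq osc_d.rep_eq

text \<open>The Leibniz rule for \<open>x_0\<close> times the derivative by \<open>x_j\<close>,
  applied to \<open>x_k / x_0\<close>: the numerator contributes the term for \<open>j = k\<close>,
  the denominator the term \<open>- z_k\<close> for \<open>j = 0\<close>. When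
  \<open>j = k = 0\<close> the two corrections cancel.\<close>

lemma osc_d_z:
  "osc_d j * osc_z k = osc_z k * osc_d j + (if j = k then 1 else 0) - (if j = 0 then osc_z k else 0)"
proof (rule osc_eqI)
  fix f :: osc_module and m :: "3 \<Rightarrow> nat"
  consider "j = 0" "k = 0" | "j = 0" "k \<noteq> 0" "m k = 0" | "j = 0" "k \<noteq> 0" "m k \<noteq> 0"
    | "j \<noteq> 0" "k = 0" | "j \<noteq> 0" "k \<noteq> 0" "j = k" "m k = 0"
    | "j \<noteq> 0" "k \<noteq> 0" "j = k" "m k \<noteq> 0" | "j \<noteq> 0" "k \<noteq> 0" "j \<noteq> k"
    by blast
  then show "osc_apply (osc_d j * osc_z k) f m =
    osc_apply (osc_z k * osc_d j + (if j = k then 1 else 0) - (if j = 0 then osc_z k else 0)) f m"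
    by cases (auto simp: osc_apply_simps osc_degree_pred scaleC_of_nat_Suc fun_upd_twist scaleC_zero_right
        scaleC_zero_left scaleC_diff_left scaleC_one simp del: of_nat_Suc)
qed

text \<open>The derivatives commute, but each carries a prefactor \<open>x_0\<close>, on which only
  the derivative by \<open>x_0\<close> acts.\<close>

lemma osc_d_d:
  "osc_d j * osc_d l = osc_d l * osc_d j + (if j = 0 then osc_d l else 0) - (if l = 0 then osc_d j else 0)"
proof (rule osc_eqI)
  fix f :: osc_module and m :: "3 \<Rightarrow> nat"
  show "osc_apply (osc_d j * osc_d l) f m =
    osc_apply (osc_d l * osc_d j + (if j = 0 then osc_d l else 0) - (if l = 0 then osc_d j else 0)) f m"
    by (cases "j = 0"; cases "l = 0"; cases "j = l")
     (auto simp: osc_apply_simps osc_degree_Suc scaleC_of_nat_Suc fun_upd_twist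
        mult_scaleC_right scaleC_scaleC scaleC_diff_right scaleC_add_right right_diff_distrib algebra_simps
        simp del: of_nat_Suc)
qed

lemma alg_hom_osc_coef: "alg_hom osc_coef"
  by (rule alg_homI; transfer; simp add: distrib_right mult.assoc mult_scaleC_left)

definition osc_const :: "osc_coeff \<Rightarrow> osc_module" where
  "osc_const r = (\<lambda>m. if m = (\<lambda>_. 0) then r else 0)"

lemma osc_coef_const: "osc_apply (osc_coef r) (osc_const s) = osc_const (r * s)"
  by (auto simp: osc_const_def osc_coef.rep_eq)

lemma osc_d_const: "j \<noteq> 0 \<Longrightarrow> osc_apply (osc_d j) (osc_const r) = (\<lambda>m. 0)"
  by (auto simp: osc_d.rep_eq osc_const_def scaleC_zero_right fun_eq_iff)

text \<open>A constant stands for a multiple of \<open>x_0^e\<close>, which has degree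
  \<open>e\<close> in \<open>x_0\<close>.\<close>

lemma osc_d_0_const: "osc_apply (osc_d 0) (osc_const r) = osc_const (osc_e * r)"
  by (auto simp: osc_d.rep_eq osc_const_def osc_degree_def scaleC_zero_right scaleC_zero_left fun_eq_iff)

section \<open>Comultiplication and evaluation\<close>

notation fps_nth (infixl \<open>$$\<close> 75)

section \<open>Central elements and series in two variables\<close>

definition central :: "'a::ring_1 \<Rightarrow> bool" where
  "central c \<longleftrightarrow> (\<forall>x. c * x = x * c)"

lemma centralD: "central c \<Longrightarrow> c * x = x * c"
  by (simp add: central_def)

lemma central_left_commute: "central c \<Longrightarrow> x * (c * y) = c * (x * y)"
  by (metis centralD mult.assoc)

lemma central_mult: "central c \<Longrightarrow> central d \<Longrightarrow> central (c * d)"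
  by (metis central_def mult.assoc)

lemma central_diff: "central c \<Longrightarrow> central d \<Longrightarrow> central (c - d)"
  by (simp add: central_def left_diff_distrib right_diff_distrib)

lemma central_uminus: "central c \<Longrightarrow> central (- c)"
  by (simp add: central_def)

lemma central_0: "central 0" and central_1: "central 1"
  by (simp_all add: central_def)

lemma central_of_nat: "central (of_nat n)"
  by (simp add: central_def mult_of_nat_commute)

lemma central_fps: "(\<And>n. central (F $$ n)) \<Longrightarrow> central F" for F :: "'a::ring_1 fps"
  unfolding central_def fps_eq_iff fps_mult_nth
proof (intro allI)
  fix G n
  assume F: "\<And>n. \<forall>x. F $$ n * x = x * F $$ n"
  have "(\<Sum>i=0..n. F $$ i * G $$ (n - i)) = (\<Sum>i=0..n. F $$ (n - i) * G $$ i)"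
    by (rule sum.reindex_bij_witness[of _ "\<lambda>i. n - i" "\<lambda>i. n - i"]) auto
  then show "(\<Sum>i=0..n. F $$ i * G $$ (n - i)) = (\<Sum>i=0..n. G $$ i * F $$ (n - i))"
    using F by simp
qed

lemma central_fps_const: "central c \<Longrightarrow> central (fps_const c)"
  by (rule central_fps) (simp add: central_0 fps_const_def)

lemma central_fps_X: "central fps_X"
  by (rule central_fps) (simp add: fps_X_def central_0 central_1)

definition fps_map :: "('a::zero \<Rightarrow> 'b::zero) \<Rightarrow> 'a fps \<Rightarrow> 'b fps" where
  "fps_map h F = Abs_fps (\<lambda>n. h (F $$ n))"

lemma fps_map_nth: "fps_map h F $$ n = h (F $$ n)"
  by (simp add: fps_map_def)

text \<open>Two commuting variables are modelled by iterated series: \<open>x\<close> is the outer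
  variable and \<open>y\<close> the variable of the coefficients. Thus \<open>at_x F\<close> has
  constant coefficients and \<open>at_y F\<close> is itself a constant.\<close>

definition at_x :: "'a::ring_1 fps \<Rightarrow> 'a fps fps" where
  "at_x F = fps_map fps_const F"

definition at_y :: "'a::ring_1 fps \<Rightarrow> 'a fps fps" where
  "at_y F = fps_const F"

lemma at_x_nth: "at_x F $$ r = fps_const (F $$ r)"
  by (simp add: at_x_def fps_map_nth)

lemma fps_const_sum: "fps_const (\<Sum>i\<in>I. f i) = (\<Sum>i\<in>I. fps_const (f i))"
  by (induction I rule: infinite_finite_induct) (simp_all flip: fps_const_add)

lemma at_x_mult: "at_x (F * G) = at_x F * at_x G"
  by (rule fps_ext) (simp add: at_x_nth fps_mult_nth fps_const_sum)

lemma at_x_add: "at_x (F + G) = at_x F + at_x G"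
  by (rule fps_ext) (simp add: at_x_nth)

lemma at_x_1: "at_x 1 = 1" and at_x_0: "at_x 0 = 0"
  by (rule fps_ext, simp add: at_x_nth)+

lemma at_y_0: "at_y 0 = 0" and at_y_1: "at_y 1 = 1"
  and at_y_mult: "at_y (F * G) = at_y F * at_y G" and at_y_add: "at_y (F + G) = at_y F + at_y G"
  by (simp_all add: at_y_def)

lemma at_x_sum: "at_x (\<Sum>i\<in>I. f i) = (\<Sum>i\<in>I. at_x (f i))"
  by (induction I rule: infinite_finite_induct) (simp_all add: at_x_0 at_x_add)

lemma at_y_sum: "at_y (\<Sum>i\<in>I. f i) = (\<Sum>i\<in>I. at_y (f i))"
  by (induction I rule: infinite_finite_induct) (simp_all add: at_y_0 at_y_add)

lemma at_x_const: "at_x (fps_const a) = fps_const (fps_const a)"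
  by (rule fps_ext) (simp add: at_x_nth)

lemma at_xy_nth: "(at_x F * at_y G) $$ r $$ s = F $$ r * G $$ s"
  and at_yx_nth: "(at_y G * at_x F) $$ r $$ s = G $$ s * F $$ r"
  by (simp_all add: at_x_nth at_y_def)

section \<open>The defining relation of the Yangian with denominators cleared, and its
  solutions\<close>

abbreviation (input) var_x :: "'a::ring_1 fps fps" where "var_x \<equiv> fps_X"
abbreviation (input) var_y :: "'a::ring_1 fps fps" where "var_y \<equiv> fps_const fps_X"

text \<open>Multiplying the Yangian relation by \<open>u - v\<close> and passing to \<open>x = 1 / u\<close>, \<open>y = 1 / v\<close>.\<close>

definition rtt :: "(3 \<Rightarrow> 3 \<Rightarrow> 'a::ring_1 fps) \<Rightarrow> bool" where
  "rtt T \<longleftrightarrow> (\<forall>i j k l.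
     (var_y - var_x) * (at_x (T i j) * at_y (T k l) - at_y (T k l) * at_x (T i j))
       = var_x * var_y * (at_x (T k j) * at_y (T i l) - at_y (T k j) * at_x (T i l)))"

lemma rtt_nth:
  "rtt T \<longleftrightarrow> (\<forall>i j k l R S.
     (if S = 0 then 0 else T i j $$ R * T k l $$ (S - 1) - T k l $$ (S - 1) * T i j $$ R)
     - (if R = 0 then 0 else T i j $$ (R - 1) * T k l $$ S - T k l $$ S * T i j $$ (R - 1))
     = (if R = 0 \<or> S = 0 then 0 else T k j $$ (R - 1) * T i l $$ (S - 1) - T k j $$ (S - 1) * T i l $$ (R - 1)))"
proof -
  have "(var_x * A) $$ R $$ S = (if R = 0 then 0 else A $$ (R - 1) $$ S)"
    "(var_y * A) $$ R $$ S = (if S = 0 then 0 else A $$ R $$ (S - 1))"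
    "(var_x * var_y * A) $$ R $$ S = (if R = 0 \<or> S = 0 then 0 else A $$ (R - 1) $$ (S - 1))"
    for A :: "'a fps fps" and R S
    by (auto simp: mult.assoc)
  then show ?thesis
    unfolding rtt_def fps_eq_iff left_diff_distrib
    by (simp only: fps_sub_nth at_xy_nth at_yx_nth)
qed

text \<open>Cleared of its denominator, the relation is a recurrence that moves one unit of degree
  from \<open>r\<close> to \<open>s\<close>. Unrolled down to \<open>r = 0\<close>, where
  \<open>T0\<close> makes the commutator vanish, it produces the sum. Conversely, the sums for
  \<open>(r + 1, s)\<close> and \<open>(r, s + 1)\<close> differ by the first summand alone, and
  \<open>T0\<close> settles the boundary indices.\<close>

lemma rtt_iff_relations:
  assumes T0: "\<And>i j. T i j $$ 0 = (if i = j then 1 else 0 :: 'a::ring_1)"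
  shows "rtt T \<longleftrightarrow> (\<forall>i j k l r s. T i j $$ r * T k l $$ s - T k l $$ s * T i j $$ r
      = (\<Sum>a<r. T k j $$ (r - 1 - a) * T i l $$ (s + a) - T k j $$ (s + a) * T i l $$ (r - 1 - a)))"
    (is "_ \<longleftrightarrow> (\<forall>i j k l r s. ?c i j k l r s = ?sum i j k l r s)")
proof
  assume T: "rtt T"
  show "\<forall>i j k l r s. ?c i j k l r s = ?sum i j k l r s"
  proof (intro allI)
    fix i j k l r s
    show "?c i j k l r s = ?sum i j k l r s"
    proof (induction r arbitrary: s)
      case 0
      then show ?case by (simp add: T0)
    next
      case (Suc r)
      have "?c i j k l (Suc r) s = ?c i j k l r (Suc s) + (T k j $$ r * T i l $$ s - T k j $$ s * T i l $$ r)"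
        using T[unfolded rtt_nth, rule_format, where R = "Suc r" and S = "Suc s" and i = i and j = j and k = k and l = l]
        by (simp add: diff_eq_eq)
      also have "\<dots> = ?sum i j k l (Suc r) s"
        unfolding Suc.IH by (subst sum.lessThan_Suc_shift) (simp add: add.commute)
      finally show ?case .
    qed
  qed
next
  assume c: "\<forall>i j k l r s. ?c i j k l r s = ?sum i j k l r s"
  show "rtt T"
    unfolding rtt_nth
  proof (intro allI)
    fix i j k l R S
    have 0: "T i j $$ r * T k l $$ 0 - T k l $$ 0 * T i j $$ r = 0" for r
      by (simp add: T0)
    have 1: "?c i j k l (Suc r) s - ?c i j k l r (Suc s) = T k j $$ r * T i l $$ s - T k j $$ s * T i l $$ r" for r s
      unfolding c[rule_format] by (subst sum.lessThan_Suc_shift) simp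
    show "(if S = 0 then 0 else T i j $$ R * T k l $$ (S - 1) - T k l $$ (S - 1) * T i j $$ R)
     - (if R = 0 then 0 else T i j $$ (R - 1) * T k l $$ S - T k l $$ S * T i j $$ (R - 1))
     = (if R = 0 \<or> S = 0 then 0 else T k j $$ (R - 1) * T i l $$ (S - 1) - T k j $$ (S - 1) * T i l $$ (R - 1))"
      using 0[of "R - 1"] 1[of "R - 1" "S - 1"] by (cases R; cases S) (simp_all add: T0)
  qed
qed

text \<open>The computation behind the comultiplication. Exchanging first the \<open>T\<close>
  factors and then the \<open>L\<close> factors leaves four double sums, two of which are mixed and
  cancel. The central elements \<open>W\<close> and \<open>Z\<close> stand for \<open>y - x\<close>
  and \<open>x y\<close>.\<close>

lemma rtt_product_identity:
  fixes Tx Ty Lx Ly :: "'i::finite \<Rightarrow> 'i \<Rightarrow> 'a::ring_1"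
  assumes T: "\<And>i j k l. W * (Tx i j * Ty k l - Ty k l * Tx i j) = Z * (Tx k j * Ty i l - Ty k j * Tx i l)"
    and L: "\<And>i j k l. W * (Lx i j * Ly k l - Ly k l * Lx i j) = Z * (Lx k j * Ly i l - Ly k j * Lx i l)"
    and c1: "\<And>i j k l. Lx i j * Ty k l = Ty k l * Lx i j"
    and c2: "\<And>i j k l. Ly i j * Tx k l = Tx k l * Ly i j"
    and W: "central W" and Z: "central Z"
  shows "W * ((\<Sum>b\<in>UNIV. Tx i b * Lx b j) * (\<Sum>d\<in>UNIV. Ty k d * Ly d l)
        - (\<Sum>d\<in>UNIV. Ty k d * Ly d l) * (\<Sum>b\<in>UNIV. Tx i b * Lx b j))
      = Z * ((\<Sum>b\<in>UNIV. Tx k b * Lx b j) * (\<Sum>d\<in>UNIV. Ty i d * Ly d l)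
        - (\<Sum>d\<in>UNIV. Ty k d * Ly d j) * (\<Sum>b\<in>UNIV. Tx i b * Lx b l))"
proof -
  have p1: "(\<Sum>b\<in>UNIV. Tx i b * Lx b j) * (\<Sum>d\<in>UNIV. Ty k d * Ly d l)
      = (\<Sum>b\<in>UNIV. \<Sum>d\<in>UNIV. Tx i b * Ty k d * (Lx b j * Ly d l))" for i j k l
    unfolding sum_product by (intro sum.cong refl) (metis c1 mult.assoc)
  have p2: "(\<Sum>d\<in>UNIV. Ty k d * Ly d l) * (\<Sum>b\<in>UNIV. Tx i b * Lx b j)
      = (\<Sum>b\<in>UNIV. \<Sum>d\<in>UNIV. Ty k d * Tx i b * (Ly d l * Lx b j))" for i j k l
    unfolding sum_product by (subst sum.swap, intro sum.cong refl) (metis c2 mult.assoc)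
  have "W * (Tx i b * Ty k d * (Lx b j * Ly d l) - Ty k d * Tx i b * (Ly d l * Lx b j))
      = Z * (Tx k b * Ty i d * (Lx b j * Ly d l)) - Z * (Ty k b * Tx i d * (Lx b j * Ly d l))
       + (Z * (Ty k d * Tx i b * (Lx d j * Ly b l)) - Z * (Ty k d * Tx i b * (Ly d j * Lx b l)))" for b d
  proof -
    have "W * (Tx i b * Ty k d * (Lx b j * Ly d l) - Ty k d * Tx i b * (Ly d l * Lx b j))
      = W * (Tx i b * Ty k d - Ty k d * Tx i b) * (Lx b j * Ly d l)
        + W * ((Ty k d * Tx i b) * (Lx b j * Ly d l - Ly d l * Lx b j))"
      by (simp add: algebra_simps)
    also have "W * ((Ty k d * Tx i b) * (Lx b j * Ly d l - Ly d l * Lx b j))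
        = Ty k d * Tx i b * (W * (Lx b j * Ly d l - Ly d l * Lx b j))"
      by (simp add: central_left_commute[OF W])
    also have "\<dots> = Z * (Ty k d * Tx i b * (Lx d j * Ly b l - Ly d j * Lx b l))"
      unfolding L by (simp add: central_left_commute[OF Z])
    also have "W * (Tx i b * Ty k d - Ty k d * Tx i b) = Z * (Tx k b * Ty i d - Ty k b * Tx i d)"
      by (rule T)
    finally show ?thesis by (simp add: algebra_simps)
  qed
  then have "W * ((\<Sum>b\<in>UNIV. \<Sum>d\<in>UNIV. Tx i b * Ty k d * (Lx b j * Ly d l))
      - (\<Sum>b\<in>UNIV. \<Sum>d\<in>UNIV. Ty k d * Tx i b * (Ly d l * Lx b j)))
    = (\<Sum>b\<in>UNIV. \<Sum>d\<in>UNIV. Z * (Tx k b * Ty i d * (Lx b j * Ly d l)))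
      - (\<Sum>b\<in>UNIV. \<Sum>d\<in>UNIV. Z * (Ty k b * Tx i d * (Lx b j * Ly d l)))
      + ((\<Sum>b\<in>UNIV. \<Sum>d\<in>UNIV. Z * (Ty k d * Tx i b * (Lx d j * Ly b l)))
      - (\<Sum>b\<in>UNIV. \<Sum>d\<in>UNIV. Z * (Ty k d * Tx i b * (Ly d j * Lx b l))))"
    by (simp add: sum_distrib_left flip: sum_subtractf sum.distrib)
  \<comment> \<open>Interchanging the names \<open>b\<close> and \<open>d\<close> identifies the two
    mixed sums, which have opposite signs.\<close>
  also have "(\<Sum>b\<in>UNIV. \<Sum>d\<in>UNIV. Z * (Ty k d * Tx i b * (Lx d j * Ly b l)))
      = (\<Sum>b\<in>UNIV. \<Sum>d\<in>UNIV. Z * (Ty k b * Tx i d * (Lx b j * Ly d l)))"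
    by (rule sum.swap)
  finally show ?thesis
    unfolding p1 p2 by (simp add: sum_distrib_left right_diff_distrib)
qed

text \<open>The comultiplication in a form without a tensor square: both families live in one
  operator algebra and commute there entry by entry.\<close>

lemma rtt_product:
  assumes T: "rtt T" and L: "rtt L"
    and comm: "\<And>i j k l r s. T i j $$ r * L k l $$ s = L k l $$ s * T i j $$ r"
  shows "rtt (\<lambda>i j. \<Sum>b\<in>UNIV. T i b * L b j)"
  unfolding rtt_def at_x_sum at_y_sum at_x_mult at_y_mult
proof (intro allI rtt_product_identity)
  show "central (var_y - var_x :: 'a fps fps)" "central (var_x * var_y :: 'a fps fps)"
    by (intro central_mult central_diff central_fps_const central_fps_X)+
  show "at_x (L i j) * at_y (T k l) = at_y (T k l) * at_x (L i j)" for i j k l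
    by (intro fps_ext) (simp only: at_xy_nth at_yx_nth comm)
  show "at_y (L i j) * at_x (T k l) = at_x (T k l) * at_y (L i j)" for i j k l
    by (intro fps_ext) (simp only: at_xy_nth at_yx_nth comm)
qed (use T L in \<open>simp_all add: rtt_def\<close>)

text \<open>Hypothesis \<open>p\<close> is the partial fraction identity of \<open>1/(u-a)\<close>
  and \<open>1/(v-a)\<close>. It converts the commutator of matrix units into the linear terms of
  the right side, whose quadratic terms cancel.\<close>

lemma rtt_evaluation_identity:
  fixes E :: "'i \<Rightarrow> 'i \<Rightarrow> 'a::ring_1"
  assumes E: "\<And>i j k l. E i j * E k l = E k l * E i j + (if j = k then E i l else 0) - (if i = l then E k j else 0)"
    and px: "central px" and py: "central py" and Z: "central Z"
    and p: "W * (px * py) = Z * (py - px)"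
  defines "L p i j \<equiv> (if i = j then 1 else 0) + p * E i j"
  shows "W * (L px i j * L py k l - L py k l * L px i j) = Z * (L px k j * L py i l - L py k j * L px i l)"
proof -
  have prod: "(c + r * A) * (d + s * B) = c * d + r * (A * d) + s * (c * B) + r * s * (A * B)"
    if s: "central s" for r s c d A B :: 'a
  proof -
    have "r * A * (s * B) = r * s * (A * B)"
      by (simp add: mult.assoc central_left_commute[OF s, of A])
    then show ?thesis
      by (simp add: distrib_left distrib_right central_left_commute[OF s, of c] mult.assoc add_ac)
  qed
  have pxy: "py * px = px * py"
    by (rule centralD[OF py])
  have "L px i j * L py k l - L py k l * L px i j = px * py * (E i j * E k l - E k l * E i j)"
    unfolding L_def prod[OF px] prod[OF py] pxy by (auto simp: right_diff_distrib)
  also have "E i j * E k l - E k l * E i j = (if j = k then E i l else 0) - (if i = l then E k j else 0)"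
    by (subst E) simp
  finally have "W * (L px i j * L py k l - L py k l * L px i j)
      = Z * ((py - px) * ((if j = k then E i l else 0) - (if i = l then E k j else 0)))"
    by (metis p mult.assoc)
  also have "(py - px) * ((if j = k then E i l else 0) - (if i = l then E k j else 0))
      = L px k j * L py i l - L py k j * L px i l"
    unfolding L_def prod[OF px] prod[OF py] pxy by (auto simp: left_diff_distrib right_diff_distrib)
  finally show ?thesis .
qed

section \<open>The representation of the Yangian on the oscillator module\<close>

definition osc_emb :: "y3 \<Rightarrow> osc_op" where
  "osc_emb y = osc_coef (y \<otimes>\<^sub>C 1)"

lemma alg_hom_osc_emb: "alg_hom osc_emb"
  unfolding osc_emb_def
  by (rule alg_homI)
    (simp_all only: alg_hom_one[OF alg_hom_osc_coef] alg_hom_add[OF alg_hom_osc_coef]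
      alg_hom_mult[OF alg_hom_osc_coef] alg_hom_scaleC[OF alg_hom_osc_coef]
      alg_hom_one[OF alg_hom_tensor_left] alg_hom_add[OF alg_hom_tensor_left]
      alg_hom_mult[OF alg_hom_tensor_left] alg_hom_scaleC[OF alg_hom_tensor_left])

lemma osc_e_commute: "(y \<otimes>\<^sub>C 1) * osc_e = osc_e * (y \<otimes>\<^sub>C 1)"
  by (simp add: osc_e_def tensor_of_mult)

lemma osc_emb_z: "osc_emb y * osc_z i = osc_z i * osc_emb y"
  by (simp add: osc_emb_def osc_coef_z)

lemma osc_emb_d: "osc_emb y * osc_d i = osc_d i * osc_emb y"
  by (simp add: osc_emb_def osc_coef_d osc_e_commute)

definition osc_E :: "3 \<Rightarrow> 3 \<Rightarrow> osc_op" where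
  "osc_E i j = osc_z i * osc_d j"

lemma osc_E_commutator:
  "osc_E i j * osc_E k l = osc_E k l * osc_E i j
    + (if j = k then osc_E i l else 0) - (if i = l then osc_E k j else 0)"
proof -
  \<comment> \<open>Normal ordering, with multiplications left of derivatives. The correction for
    \<open>j = 0\<close> cancels later against the commutator of the two derivatives.\<close>
  have swap: "osc_E i j * osc_E k l = osc_z i * osc_z k * (osc_d j * osc_d l)
      + (if j = k then osc_E i l else 0) - (if j = 0 then osc_z i * osc_z k * osc_d l else 0)" for i j k l
  proof -
    have "osc_E i j * osc_E k l = osc_z i * (osc_d j * osc_z k) * osc_d l"
      by (simp add: osc_E_def mult.assoc)
    then show ?thesis
      by (auto simp: osc_d_z osc_E_def algebra_simps)
  qed
  show ?thesis
    unfolding swap[of i j k l] swap[of k l i j] osc_d_d[of j l] osc_z_commute[of k i]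
    by (auto simp: algebra_simps)
qed

text \<open>The series \<open>1 / (u - 2)\<close> and \<open>1 / (u + 2)\<close>.\<close>

definition pole_p :: "'a::ring_1 fps" where
  "pole_p = Abs_fps (\<lambda>n. if n = 0 then 0 else of_nat (2 ^ (n - 1)))"

definition pole_q :: "'a::ring_1 fps" where
  "pole_q = Abs_fps (\<lambda>n. if n = 0 then 0 else (- 1) ^ (n - 1) * of_nat (2 ^ (n - 1)))"

lemma central_power: "central c \<Longrightarrow> central (c ^ n)"
  by (induction n) (simp_all add: central_1 central_mult)

lemma central_pole_p: "central pole_p" and central_pole_q: "central pole_q"
  unfolding pole_p_def pole_q_def
  by (intro central_fps; simp add: central_0 central_of_nat central_mult central_power central_uminus
      central_1 flip: of_nat_power)+

text \<open>The equation \<open>u p = 1 + 2 p\<close> of \<open>p = 1/(u-2)\<close>, written in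
  \<open>1/u\<close>. It drives both \<open>pole_p_difference\<close> and
  \<open>pole_p_cancel\<close>.\<close>

lemma pole_p_eq: "pole_p = fps_X * (1 + pole_p + pole_p)"
proof (rule fps_ext)
  show "pole_p $$ n = (fps_X * (1 + pole_p + pole_p) :: 'a fps) $$ n" for n
    by (cases n; cases "n - 1") (simp_all add: pole_p_def mult_2)
qed

lemma at_x_X: "at_x fps_X = fps_X"
  by (rule fps_ext) (simp add: at_x_nth)

lemma at_y_X: "at_y fps_X = var_y"
  by (simp add: at_y_def)

lemma pole_p_difference:
  "(var_y - var_x) * (at_x pole_p * at_y pole_p) = var_x * var_y * (at_y pole_p - at_x pole_p :: 'a::ring_1 fps fps)"
proof -
  define x y px py :: "'a fps fps" where "x = var_x" and "y = var_y" and "px = at_x pole_p" and "py = at_y pole_p"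
  have px: "px = x * (1 + px + px)"
    unfolding px_def x_def by (subst pole_p_eq) (simp only: at_x_mult at_x_add at_x_1 at_x_X)
  have py: "py = y * (1 + py + py)"
    unfolding py_def y_def by (subst pole_p_eq) (simp only: at_y_mult at_y_add at_y_1 at_y_X)
  have cx: "central x" and cy: "central y"
    by (auto simp: x_def y_def intro: central_fps_X central_fps_const)
  have "y * (px * py) = y * (x * (1 + px + px) * py)"
    using px by simp
  also have "\<dots> = x * y * (py + px * py + px * py)"
    by (simp add: distrib_left distrib_right mult.assoc central_left_commute[OF cx, of y])
  finally have 1: "y * (px * py) = x * y * (py + px * py + px * py)" .
  have "x * (px * py) = x * (px * (y * (1 + py + py)))"
    using py by simp
  also have "\<dots> = x * y * (px + px * py + px * py)"
    by (simp add: central_left_commute[OF cy, of px]) (simp add: distrib_left mult.assoc)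
  finally have 2: "x * (px * py) = x * y * (px + px * py + px * py)" .
  show ?thesis
    unfolding x_def[symmetric] y_def[symmetric] px_def[symmetric] py_def[symmetric] left_diff_distrib 1 2
    by (simp add: algebra_simps)
qed

definition osc_L :: "3 \<Rightarrow> 3 \<Rightarrow> osc_op fps" where
  "osc_L i j = (if i = j then 1 else 0) + pole_p * fps_const (osc_E i j)"

lemma rtt_osc_L: "rtt osc_L"
  unfolding rtt_def
proof (intro allI)
  fix i j k l
  let ?E = "\<lambda>i j. fps_const (fps_const (osc_E i j))"
  have x: "at_x (osc_L i j) = (if i = j then 1 else 0) + at_x pole_p * ?E i j" for i j
    by (simp add: osc_L_def at_x_add at_x_mult at_x_const at_x_0 at_x_1)
  have y: "at_y (osc_L i j) = (if i = j then 1 else 0) + at_y pole_p * ?E i j" for i j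
    by (simp add: osc_L_def at_y_add at_y_mult at_y_0 at_y_1) (simp add: at_y_def)
  show "(var_y - var_x) * (at_x (osc_L i j) * at_y (osc_L k l) - at_y (osc_L k l) * at_x (osc_L i j))
       = var_x * var_y * (at_x (osc_L k j) * at_y (osc_L i l) - at_y (osc_L k j) * at_x (osc_L i l))"
    unfolding x y
  proof (rule rtt_evaluation_identity)
    show "?E i j * ?E k l = ?E k l * ?E i j + (if j = k then ?E i l else 0) - (if i = l then ?E k j else 0)"
      for i j k l
      using osc_E_commutator[of i j k l] by (simp split: if_splits)
    show "central (at_x pole_p :: osc_op fps fps)"
      by (rule central_fps)
        (simp add: at_x_nth central_fps_const central_of_nat central_0 pole_p_def flip: of_nat_power)
    show "central (at_y pole_p :: osc_op fps fps)"
      by (simp add: at_y_def central_fps_const central_pole_p)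
    show "central (var_x * var_y :: osc_op fps fps)"
      by (intro central_mult central_fps_const central_fps_X)
  qed (rule pole_p_difference)
qed

lemma y3_T_coeff_relation:
  "y3_T_coeff i j r * y3_T_coeff k l s - y3_T_coeff k l s * y3_T_coeff i j r
    = (\<Sum>a<r. y3_T_coeff k j (r - 1 - a) * y3_T_coeff i l (s + a)
      - y3_T_coeff k j (s + a) * y3_T_coeff i l (r - 1 - a))"
proof -
  have abs_sum: "abs_y3 (\<Sum>a\<in>I. f a) = (\<Sum>a\<in>I. abs_y3 (f a))" for f and I :: "nat set"
    by (induction I rule: infinite_finite_induct) (simp_all flip: plus_y3.abs_eq zero_y3_def)
  have "abs_y3 (free_T i j r * free_T k l s - free_T k l s * free_T i j r)
     = abs_y3 (\<Sum>a<r. free_T k j (r - 1 - a) * free_T i l (s + a)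
               - free_T k j (s + a) * free_T i l (r - 1 - a))"
    unfolding y3.abs_eq_iff by (rule hull_inc, unfold y3_relations_def, blast)
  then show ?thesis
    by (simp add: abs_sum y3_T_coeff.abs_eq flip: minus_y3.abs_eq times_y3.abs_eq)
qed

context
  fixes h :: "'a::{ring_1,complex_algebra} \<Rightarrow> 'b::{ring_1,complex_algebra}"
  assumes h: "alg_hom h"
begin

lemma fps_map_add: "fps_map h (F + G) = fps_map h F + fps_map h G"
  by (rule fps_ext) (simp add: fps_map_nth alg_hom_add[OF h])

lemma fps_map_diff: "fps_map h (F - G) = fps_map h F - fps_map h G"
  by (rule fps_ext) (simp add: fps_map_nth alg_hom_diff[OF h])

lemma fps_map_mult: "fps_map h (F * G) = fps_map h F * fps_map h G"
  by (rule fps_ext) (simp add: fps_map_nth fps_mult_nth alg_hom_sum[OF h] alg_hom_mult[OF h])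

lemma fps_map_0: "fps_map h 0 = 0"
  by (rule fps_ext) (simp add: fps_map_nth alg_hom_zero[OF h])

lemma fps_map_1: "fps_map h 1 = 1"
  by (rule fps_ext) (simp add: fps_map_nth alg_hom_one[OF h] alg_hom_zero[OF h])

lemma fps_map_sum: "fps_map h (\<Sum>i\<in>I. f i) = (\<Sum>i\<in>I. fps_map h (f i))"
  by (induction I rule: infinite_finite_induct) (simp_all add: fps_map_0 fps_map_add)

end

lemma rtt_osc_emb: "rtt (\<lambda>i j. fps_map osc_emb (y3_T i j))"
proof -
  note simps = alg_hom_mult[OF alg_hom_osc_emb, symmetric] alg_hom_diff[OF alg_hom_osc_emb, symmetric]
     alg_hom_sum[OF alg_hom_osc_emb, symmetric]
  show ?thesis
  proof (subst rtt_iff_relations)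
    show "fps_map osc_emb (y3_T i j) $$ 0 = (if i = j then 1 else 0)" for i j
      by (simp add: fps_map_nth y3_T_def y3_T_coeff_0 alg_hom_one[OF alg_hom_osc_emb] alg_hom_zero[OF alg_hom_osc_emb])
  qed (simp only: fps_map_nth y3_T_def fps_nth_Abs_fps simps y3_T_coeff_relation, simp)
qed

definition osc_T :: "3 \<Rightarrow> 3 \<Rightarrow> osc_op fps" where
  "osc_T i j = (\<Sum>b\<in>UNIV. fps_map osc_emb (y3_T i b) * osc_L b j)"

lemma pole_p_0: "pole_p $$ 0 = 0"
  by (simp add: pole_p_def)

lemma osc_emb_E: "osc_emb y * osc_E i j = osc_E i j * osc_emb y"
  unfolding osc_E_def by (metis mult.assoc osc_emb_d osc_emb_z)

text \<open>The commutation that \<open>rtt_product\<close> asks for: \<open>Y_3\<close> sits in the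
  first tensor factor, \<open>e\<close> in the second, and the oscillators act on exponents
  only.\<close>

lemma osc_emb_L: "osc_emb y * osc_L i j $$ s = osc_L i j $$ s * osc_emb y"
proof -
  have c: "central (pole_p $$ s :: osc_op)"
    by (simp add: pole_p_def central_0 central_of_nat flip: of_nat_power)
  then show ?thesis
    by (simp add: osc_L_def distrib_left distrib_right mult.assoc central_left_commute[OF c] osc_emb_E
        fps_mult_right_const_nth)
qed

lemma rtt_osc_T: "rtt osc_T"
  unfolding osc_T_def
  by (rule rtt_product[OF rtt_osc_emb rtt_osc_L]) (simp add: fps_map_nth osc_emb_L)

lemma osc_T_0: "osc_T i j $$ 0 = (if i = j then 1 else 0)"
proof -
  have "fps_map osc_emb (y3_T i b) $$ 0 = (if i = b then 1 else 0)" for b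
    by (simp add: fps_map_nth y3_T_def y3_T_coeff_0 alg_hom_one[OF alg_hom_osc_emb] alg_hom_zero[OF alg_hom_osc_emb])
  moreover have "osc_L b j $$ 0 = (if b = j then 1 else 0)" for b
    by (simp add: osc_L_def pole_p_0)
  ultimately show ?thesis
    by (simp add: osc_T_def fps_sum_nth if_distrib[of "\<lambda>x. x * _"] cong: if_cong)
qed

definition osc_rep :: "y3 \<Rightarrow> osc_op" where
  "osc_rep = (SOME \<rho>. alg_hom \<rho> \<and> (\<forall>i j r. \<rho> (y3_T_coeff i j r) = osc_T i j $$ r))"

lemma alg_hom_osc_rep: "alg_hom osc_rep"
  and osc_rep_T_coeff: "osc_rep (y3_T_coeff i j r) = osc_T i j $$ r"
proof -
  have "\<exists>\<rho>. alg_hom \<rho> \<and> (\<forall>i j r. \<rho> (y3_T_coeff i j r) = osc_T i j $$ r)"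
    by (rule y3_hom_exists[where t = "\<lambda>i j r. osc_T i j $$ r"])
      (simp add: osc_T_0, use rtt_osc_T rtt_iff_relations[of osc_T, OF osc_T_0] in blast)
  from someI_ex[OF this] show "alg_hom osc_rep" "osc_rep (y3_T_coeff i j r) = osc_T i j $$ r"
    unfolding osc_rep_def by blast+
qed

section \<open>The substitution \<open>u -> -u\<close> and the image of \<open>S(u)\<close>\<close>

definition fps_neg :: "'a::ring_1 fps \<Rightarrow> 'a fps" where
  "fps_neg F = Abs_fps (\<lambda>n. (- 1) ^ n * F $$ n)"

lemma minus_one_power_commute: "(- 1) ^ n * x = x * (- 1) ^ n" for x :: "'a::ring_1"
  by (cases "even n") simp_all

lemma fps_neg_nth: "fps_neg F $$ n = (- 1) ^ n * F $$ n"
  by (simp add: fps_neg_def)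

lemma fps_neg_add: "fps_neg (F + G) = fps_neg F + fps_neg G"
  by (rule fps_ext) (simp add: fps_neg_nth distrib_left)

lemma fps_neg_0: "fps_neg 0 = 0" and fps_neg_1: "fps_neg 1 = 1"
  by (rule fps_ext, simp add: fps_neg_nth)+

lemma fps_neg_sum: "fps_neg (\<Sum>i\<in>I. f i) = (\<Sum>i\<in>I. fps_neg (f i))"
  by (induction I rule: infinite_finite_induct) (simp_all add: fps_neg_0 fps_neg_add)

lemma fps_neg_mult: "fps_neg (F * G) = fps_neg F * fps_neg G"
proof (rule fps_ext)
  fix n
  have "(- 1) ^ n * (F $$ i * G $$ (n - i)) = (- 1) ^ i * F $$ i * ((- 1) ^ (n - i) * G $$ (n - i))"
    if "i \<le> n" for i
  proof -
    have "(- 1) ^ n = (- 1) ^ i * (- 1 :: 'a) ^ (n - i)"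
      using that by (simp flip: power_add)
    then show ?thesis
      by (simp add: mult.assoc) (metis minus_one_power_commute mult.assoc)
  qed
  then show "fps_neg (F * G) $$ n = (fps_neg F * fps_neg G) $$ n"
    by (simp add: fps_neg_nth fps_mult_nth sum_distrib_left)
qed

lemma fps_neg_pole_p: "fps_neg pole_p = - pole_q"
  by (rule fps_ext, rename_tac n, case_tac n) (simp_all add: fps_neg_nth pole_p_def pole_q_def)

lemma fps_mult_commuteI:
  assumes "\<And>r s. F $$ r * G $$ s = G $$ s * F $$ r"
  shows "F * G = G * F"
proof (rule fps_ext)
  fix n
  have "(\<Sum>i=0..n. F $$ i * G $$ (n - i)) = (\<Sum>i=0..n. F $$ (n - i) * G $$ i)"
    by (rule sum.reindex_bij_witness[of _ "\<lambda>i. n - i" "\<lambda>i. n - i"]) auto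
  then show "(F * G) $$ n = (G * F) $$ n"
    by (simp add: fps_mult_nth assms)
qed

lemma fps_map_neg: "alg_hom h \<Longrightarrow> fps_map h (fps_neg F) = fps_neg (fps_map h F)"
  by (rule fps_ext, rename_tac n, case_tac "even n")
    (simp_all add: fps_map_nth fps_neg_nth alg_hom_uminus)

text \<open>This is \<open>osc_L\<close> at \<open>-u\<close>; the sign and the new pole come from
  \<open>1/(-u-2) = -1/(u+2)\<close>.\<close>

definition osc_M :: "3 \<Rightarrow> 3 \<Rightarrow> osc_op fps" where
  "osc_M i j = (if i = j then 1 else 0) - pole_q * fps_const (osc_E i j)"

lemma fps_neg_const: "fps_neg (fps_const a) = fps_const a"
  by (rule fps_ext) (simp add: fps_neg_nth)

lemma fps_neg_osc_L: "fps_neg (osc_L i j) = osc_M i j"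
  by (simp add: osc_L_def osc_M_def fps_neg_add fps_neg_mult fps_neg_pole_p fps_neg_const fps_neg_0 fps_neg_1)

lemma osc_emb_M: "osc_emb y * osc_M i j $$ s = osc_M i j $$ s * osc_emb y"
  unfolding fps_neg_osc_L[symmetric] fps_neg_nth
  by (metis minus_one_power_commute mult.assoc osc_emb_L)

abbreviation emb_S :: "3 \<Rightarrow> 3 \<Rightarrow> osc_op fps" where
  "emb_S a b \<equiv> fps_map osc_emb (y3_S a b)"

lemma y3_eta_T_eq: "y3_eta_T i j = fps_neg (y3_T (- j) (- i))"
  by (rule fps_ext) (simp add: y3_eta_T_def y3_T_def fps_neg_nth)

lemma bij_uminus_3: "bij (uminus :: 3 \<Rightarrow> 3)"
  by (rule o_bij[of uminus]) (auto simp: fun_eq_iff)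

text \<open>The coideal property of the twisted Yangian: after comultiplication, the first factors
  of \<eta>(T) and T meet in the sum over \<open>k\<close> and recombine to \<open>S_{a,b}\<close>.
  This needs the \<open>osc_M\<close> factors to commute with the embedded
  \<open>Y_3\<close>.\<close>

lemma osc_rep_S:
  "fps_map osc_rep (y3_S i j) = (\<Sum>a\<in>UNIV. \<Sum>b\<in>UNIV. emb_S a b * (osc_M (- a) (- i) * osc_L b j))"
proof -
  let ?T = "\<lambda>i j. fps_map osc_emb (y3_T i j)"
  have T: "fps_map osc_rep (y3_T i j) = (\<Sum>b\<in>UNIV. ?T i b * osc_L b j)" for i j
    by (rule fps_ext) (simp add: fps_map_nth y3_T_def osc_rep_T_coeff osc_T_def)
  have eta: "fps_map osc_rep (y3_eta_T i k) = (\<Sum>a\<in>UNIV. fps_map osc_emb (y3_eta_T a k) * osc_M (- a) (- i))" for k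
  proof -
    have "fps_map osc_rep (y3_eta_T i k) = (\<Sum>b\<in>UNIV. fps_neg (?T (- k) b) * osc_M b (- i))"
      by (simp add: y3_eta_T_eq fps_map_neg[OF alg_hom_osc_rep] T fps_neg_sum fps_neg_mult fps_neg_osc_L)
    also have "\<dots> = (\<Sum>a\<in>UNIV. fps_neg (?T (- k) (- a)) * osc_M (- a) (- i))"
      by (rule sum.reindex_bij_betw[OF bij_uminus_3, symmetric])
    finally show ?thesis
      by (simp add: y3_eta_T_eq fps_map_neg[OF alg_hom_osc_emb])
  qed
  have comm: "osc_M a b * ?T i j = ?T i j * osc_M a b" for a b i j
    by (rule fps_mult_commuteI) (simp add: fps_map_nth osc_emb_M)
  have "fps_map osc_rep (y3_S i j)
      = (\<Sum>k\<in>UNIV. (\<Sum>a\<in>UNIV. fps_map osc_emb (y3_eta_T a k) * osc_M (- a) (- i)) * (\<Sum>b\<in>UNIV. ?T k b * osc_L b j))"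
    by (simp add: y3_S_def fps_map_sum[OF alg_hom_osc_rep] fps_map_mult[OF alg_hom_osc_rep] T eta)
  also have "\<dots> = (\<Sum>k\<in>UNIV. \<Sum>a\<in>UNIV. \<Sum>b\<in>UNIV. fps_map osc_emb (y3_eta_T a k) * ?T k b * (osc_M (- a) (- i) * osc_L b j))"
    unfolding sum_product by (intro sum.cong refl) (metis comm mult.assoc)
  also have "\<dots> = (\<Sum>a\<in>UNIV. \<Sum>b\<in>UNIV. \<Sum>k\<in>UNIV. fps_map osc_emb (y3_eta_T a k) * ?T k b * (osc_M (- a) (- i) * osc_L b j))"
    by (rule trans[OF sum.swap], rule sum.cong[OF refl], rule sum.swap)
  also have "\<dots> = (\<Sum>a\<in>UNIV. \<Sum>b\<in>UNIV. emb_S a b * (osc_M (- a) (- i) * osc_L b j))"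
    by (simp add: y3_S_def fps_map_sum[OF alg_hom_osc_emb] fps_map_mult[OF alg_hom_osc_emb] sum_distrib_right)
  finally show ?thesis .
qed

definition osc_Z :: "3 \<Rightarrow> osc_op fps" where "osc_Z i = fps_const (osc_z i)"
definition osc_D :: "3 \<Rightarrow> osc_op fps" where "osc_D i = fps_const (osc_d i)"

lemma osc_D_Z: "osc_D j * osc_Z k
    = osc_Z k * osc_D j + (if j = k then 1 else 0) - (if j = 0 then osc_Z k else 0)"
  using osc_d_z[of j k] by (simp add: osc_D_def osc_Z_def split: if_splits)

text \<open>\<open>osc_V\<close>, \<open>osc_U\<close> and \<open>osc_Q\<close> contract the matrix
  \<open>S\<close> with the vectors \<open>(z_b)\<close> and \<open>(z_{-a})\<close> on the right,
  on the left and on both sides. Multiplications by \<open>z\<close> enter the image of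
  \<open>S\<close> only through these three series.\<close>

definition osc_V :: "3 \<Rightarrow> osc_op fps" where
  "osc_V i = (\<Sum>b\<in>UNIV. emb_S i b * osc_Z b)"

definition osc_U :: "3 \<Rightarrow> osc_op fps" where
  "osc_U j = (\<Sum>a\<in>UNIV. emb_S a j * osc_Z (- a))"

definition osc_Q :: "osc_op fps" where
  "osc_Q = (\<Sum>a\<in>UNIV. \<Sum>b\<in>UNIV. emb_S a b * (osc_Z (- a) * osc_Z b))"

text \<open>Derivatives are moved to the far right so that the action on constants can be read off.
  The linear terms of the last bracket arise when \<open>osc_D (- i)\<close> passes
  \<open>osc_Z b\<close>.\<close>

lemma osc_rep_S_expand:
  "fps_map osc_rep (y3_S i j) = emb_S i j + pole_p * (osc_V i * osc_D j) - pole_q * (osc_U j * osc_D (- i))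
     - pole_p * pole_q * (osc_Q * (osc_D (- i) * osc_D j) + osc_U (- i) * osc_D j - (if i = 0 then osc_Q * osc_D j else 0))"
proof -
  let ?p = "pole_p :: osc_op fps" and ?q = "pole_q :: osc_op fps"
  note p = central_left_commute[OF central_pole_p] and q = central_left_commute[OF central_pole_q]
  have dz: "osc_D (- i) * osc_Z b = osc_Z b * osc_D (- i) + (if b = - i then 1 else 0) - (if i = 0 then osc_Z b else 0)" for b
    using osc_D_Z[of "- i" b] by (auto split: if_splits)
  have tm: "emb_S a b * (osc_M (- a) (- i) * osc_L b j)
    = (if a = i then if b = j then emb_S a b else 0 else 0)
     + (if a = i then ?p * (emb_S a b * osc_Z b * osc_D j) else 0)
     - (if b = j then ?q * (emb_S a b * osc_Z (- a) * osc_D (- i)) else 0)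
     - ?p * ?q * (emb_S a b * (osc_Z (- a) * osc_Z b) * (osc_D (- i) * osc_D j)
         + (if b = - i then emb_S a b * osc_Z (- a) * osc_D j else 0)
         - (if i = 0 then emb_S a b * (osc_Z (- a) * osc_Z b) * osc_D j else 0))" for a b
  proof -
    have L: "osc_L b j = (if b = j then 1 else 0) + ?p * (osc_Z b * osc_D j)"
      by (simp add: osc_L_def osc_E_def osc_D_def osc_Z_def)
    have M: "osc_M (- a) (- i) = (if a = i then 1 else 0) - ?q * (osc_Z (- a) * osc_D (- i))"
      by (simp add: osc_M_def osc_E_def osc_D_def osc_Z_def)
    have "(?q * (osc_Z (- a) * osc_D (- i))) * (?p * (osc_Z b * osc_D j)) = ?p * ?q * (osc_Z (- a) * (osc_D (- i) * osc_Z b) * osc_D j)"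
      by (simp only: mult.assoc p)
    also have "\<dots> = ?p * ?q * (osc_Z (- a) * osc_Z b * (osc_D (- i) * osc_D j)
        + (if b = - i then osc_Z (- a) * osc_D j else 0) - (if i = 0 then osc_Z (- a) * osc_Z b * osc_D j else 0))"
      unfolding dz by (simp add: distrib_left distrib_right left_diff_distrib right_diff_distrib mult.assoc)
    finally have "osc_M (- a) (- i) * osc_L b j
      = (if a = i then if b = j then 1 else 0 else 0)
       + (if a = i then ?p * (osc_Z b * osc_D j) else 0) - (if b = j then ?q * (osc_Z (- a) * osc_D (- i)) else 0)
       - ?p * ?q * (osc_Z (- a) * osc_Z b * (osc_D (- i) * osc_D j)
        + (if b = - i then osc_Z (- a) * osc_D j else 0) - (if i = 0 then osc_Z (- a) * osc_Z b * osc_D j else 0))"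
      unfolding L M by (simp add: distrib_left left_diff_distrib)
    moreover have "s * (A + B - C - ?p * ?q * (D1 + D2 - D3))
       = s * A + s * B - s * C - ?p * ?q * (s * D1 + s * D2 - s * D3)" for s A B C D1 D2 D3
      by (simp only: distrib_left right_diff_distrib mult.assoc p[of s] q[of s])
    moreover have "s * (if P then A else B) = (if P then s * A else s * B)" for s A B :: "osc_op fps" and P
      by simp
    ultimately show ?thesis
      by (simp only: mult_1_right mult_zero_right p[of "emb_S a b"] q[of "emb_S a b"] mult.assoc)
  qed
  have sum_if: "(\<Sum>a\<in>UNIV. if a = i then f a else 0) = f i" "(\<Sum>a\<in>UNIV. if i = a then f a else 0) = f i"
    for f :: "3 \<Rightarrow> osc_op fps" and i
    by simp_all
  have if0: "(\<Sum>b\<in>UNIV. if P then f b else 0) = (if P then \<Sum>b\<in>UNIV. f b else 0)"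
    for P and f :: "3 \<Rightarrow> osc_op fps"
    by simp
  show ?thesis
    unfolding osc_rep_S tm osc_V_def osc_U_def osc_Q_def
    by (simp only: sum.distrib sum_subtractf sum_distrib_left[symmetric] sum_distrib_right[symmetric]
        sum_if if0)
qed

section \<open>Action on constants\<close>

text \<open>Congruence modulo the left ideal of the operators that kill the constants. It may be multiplied
  on the right only by series that map constants to constants.\<close>

definition osc_cong :: "osc_op fps \<Rightarrow> osc_op fps \<Rightarrow> bool"  (infix \<open>\<doteq>\<close> 50) where
  "A \<doteq> B \<longleftrightarrow> (\<forall>n r. osc_apply (A $$ n) (osc_const r) = osc_apply (B $$ n) (osc_const r))"

lemma osc_cong_refl: "A \<doteq> A"
  by (simp add: osc_cong_def)

lemma osc_cong_sym: "A \<doteq> B \<Longrightarrow> B \<doteq> A"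
  by (simp add: osc_cong_def)

lemma osc_cong_trans [trans]: "A \<doteq> B \<Longrightarrow> B \<doteq> C \<Longrightarrow> A \<doteq> C"
  by (simp add: osc_cong_def)

lemma osc_cong_add: "A \<doteq> B \<Longrightarrow> C \<doteq> D \<Longrightarrow> A + C \<doteq> B + D"
  by (simp add: osc_cong_def plus_osc_op.rep_eq)

lemma osc_cong_diff: "A \<doteq> B \<Longrightarrow> C \<doteq> D \<Longrightarrow> A - C \<doteq> B - D"
  by (simp add: osc_cong_def minus_osc_op.rep_eq)

lemma osc_cong_sum: "(\<And>i. i \<in> I \<Longrightarrow> f i \<doteq> g i) \<Longrightarrow> (\<Sum>i\<in>I. f i) \<doteq> (\<Sum>i\<in>I. g i)"
  by (induction I rule: infinite_finite_induct) (auto intro: osc_cong_refl osc_cong_add)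

lemma osc_apply_sum: "osc_apply (\<Sum>i\<in>I. a i) f = (\<lambda>m. \<Sum>i\<in>I. osc_apply (a i) f m)"
  by (induction I rule: infinite_finite_induct) (simp_all add: zero_osc_op.rep_eq plus_osc_op.rep_eq)

lemma osc_cong_mult_left: "A \<doteq> B \<Longrightarrow> C * A \<doteq> C * B"
  by (simp add: osc_cong_def fps_mult_nth osc_apply_sum times_osc_op.rep_eq)

definition osc_scalar :: "osc_op fps \<Rightarrow> bool" where
  "osc_scalar F \<longleftrightarrow> (\<forall>n. F $$ n \<in> range osc_coef)"

lemma osc_cong_mult_right:
  assumes "A \<doteq> B" "osc_scalar F"
  shows "A * F \<doteq> B * F"
proof -
  have "osc_apply (A $$ i * F $$ n) (osc_const r) = osc_apply (B $$ i * F $$ n) (osc_const r)" for i n r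
  proof -
    obtain s where "F $$ n = osc_coef s"
      using assms(2) by (auto simp: osc_scalar_def)
    then show ?thesis
      using assms(1) by (simp add: times_osc_op.rep_eq osc_coef_const osc_cong_def)
  qed
  then show ?thesis
    by (simp add: osc_cong_def fps_mult_nth osc_apply_sum)
qed

lemma osc_coef_closed:
  shows "0 \<in> range osc_coef" "1 \<in> range osc_coef"
    and "a \<in> range osc_coef \<Longrightarrow> b \<in> range osc_coef \<Longrightarrow> a + b \<in> range osc_coef"
    and "a \<in> range osc_coef \<Longrightarrow> b \<in> range osc_coef \<Longrightarrow> a * b \<in> range osc_coef"
proof -
  show "0 \<in> range osc_coef" "1 \<in> range osc_coef"
    by (metis alg_hom_osc_coef alg_hom_zero rangeI, metis alg_hom_osc_coef alg_hom_one rangeI)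
  show "a + b \<in> range osc_coef" "a * b \<in> range osc_coef" if "a \<in> range osc_coef" "b \<in> range osc_coef"
    using that by (auto simp flip: alg_hom_add[OF alg_hom_osc_coef] alg_hom_mult[OF alg_hom_osc_coef])
qed

lemma osc_coef_sum_closed: "(\<And>i. i \<in> I \<Longrightarrow> f i \<in> range osc_coef) \<Longrightarrow> (\<Sum>i\<in>I. f i) \<in> range osc_coef"
  by (induction I rule: infinite_finite_induct) (auto intro: osc_coef_closed)

lemma osc_scalar_mult: "osc_scalar F \<Longrightarrow> osc_scalar G \<Longrightarrow> osc_scalar (F * G)"
  by (auto simp: osc_scalar_def fps_mult_nth intro!: osc_coef_sum_closed osc_coef_closed)

lemma osc_scalar_add: "osc_scalar F \<Longrightarrow> osc_scalar G \<Longrightarrow> osc_scalar (F + G)"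
  by (auto simp: osc_scalar_def intro!: osc_coef_closed)

lemma osc_scalar_1: "osc_scalar 1" and osc_scalar_X: "osc_scalar fps_X"
  by (auto simp: osc_scalar_def fps_X_def intro: osc_coef_closed)

lemma osc_scalar_const: "osc_scalar (fps_const (osc_coef r))"
  by (auto simp: osc_scalar_def fps_const_def intro: osc_coef_closed)

lemma osc_scalar_emb: "osc_scalar (fps_map osc_emb F)"
  by (simp add: osc_scalar_def fps_map_nth osc_emb_def)

definition osc_ec :: "osc_op fps" where
  "osc_ec = fps_const (osc_coef osc_e)"

lemma osc_scalar_ec: "osc_scalar osc_ec"
  by (simp add: osc_ec_def osc_scalar_const)

lemma osc_emb_ec: "osc_ec * fps_map osc_emb F = fps_map osc_emb F * osc_ec"
proof (rule fps_mult_commuteI)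
  have "osc_coef osc_e * osc_emb y = osc_emb y * osc_coef osc_e" for y
    by (simp add: osc_emb_def osc_e_commute flip: alg_hom_mult[OF alg_hom_osc_coef])
  then show "osc_ec $$ r * fps_map osc_emb F $$ s = fps_map osc_emb F $$ s * osc_ec $$ r" for r s
    by (simp add: osc_ec_def fps_map_nth)
qed

lemma osc_emb_Z: "osc_Z i * fps_map osc_emb F = fps_map osc_emb F * osc_Z i"
  by (rule fps_mult_commuteI) (simp add: osc_Z_def fps_map_nth osc_emb_z)

lemma osc_Z_0: "osc_Z 0 = 1"
  by (simp add: osc_Z_def osc_z_0)

lemma osc_D_cong: "osc_D j \<doteq> (if j = 0 then osc_ec else 0)"
proof -
  have "osc_apply (osc_D j $$ n) (osc_const r) = osc_apply ((if j = 0 then osc_ec else 0) $$ n) (osc_const r)" for n r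
    by (cases "n = 0"; cases "j = 0")
      (simp_all add: osc_D_def osc_ec_def osc_d_const osc_d_0_const osc_coef_const zero_osc_op.rep_eq)
  then show ?thesis
    by (simp add: osc_cong_def)
qed

lemma osc_D_D_cong: "osc_D i * osc_D j \<doteq> (if i = 0 \<and> j = 0 then osc_ec * osc_ec else 0)"
proof -
  have "osc_D i * osc_D j \<doteq> osc_D i * (if j = 0 then osc_ec else 0)"
    by (intro osc_cong_mult_left osc_D_cong)
  also have "\<dots> \<doteq> (if i = 0 \<and> j = 0 then osc_ec * osc_ec else 0)"
    using osc_cong_mult_right[OF osc_D_cong osc_scalar_ec, of i] by (auto intro: osc_cong_refl)
  finally show ?thesis .
qed

text \<open>On the linear monomial \<open>z_l\<close> the operator \<open>osc_D 0\<close> acts as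
  \<open>e - 1\<close> instead of \<open>e\<close>.\<close>

lemma osc_D_Z_cong:
  assumes "l \<noteq> 0"
  shows "osc_D j * osc_Z l \<doteq> (if j = 0 then osc_Z l * osc_ec - osc_Z l else if j = l then 1 else 0)"
proof -
  have "osc_D j * osc_Z l \<doteq> osc_Z l * (if j = 0 then osc_ec else 0)
      + (if j = l then 1 else 0) - (if j = 0 then osc_Z l else 0)"
    unfolding osc_D_Z by (intro osc_cong_add osc_cong_diff osc_cong_refl osc_cong_mult_left osc_D_cong)
  also have "\<dots> = (if j = 0 then osc_Z l * osc_ec - osc_Z l else if j = l then 1 else 0)"
    using assms by auto
  finally show ?thesis .
qed

lemma osc_D_D_Z_cong:
  assumes "j \<noteq> 0" "l \<noteq> 0"
  shows "osc_D i * osc_D j * osc_Z l \<doteq> (if i = 0 \<and> j = l then osc_ec else 0)"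
proof -
  have "osc_D i * osc_D j * osc_Z l \<doteq> osc_D i * (if j = l then 1 else 0)"
    unfolding mult.assoc using osc_cong_mult_left[OF osc_D_Z_cong[OF assms(2)], of "osc_D i" j] assms(1) by simp
  also have "\<dots> \<doteq> (if i = 0 \<and> j = l then osc_ec else 0)"
    using osc_D_cong[of i] by (auto intro: osc_cong_refl)
  finally show ?thesis .
qed

lemma osc_rep_S_cong:
  "fps_map osc_rep (y3_S i j) \<doteq> emb_S i j + pole_p * (osc_V i * (if j = 0 then osc_ec else 0))
     - pole_q * (osc_U j * (if i = 0 then osc_ec else 0))
     - pole_p * pole_q * (osc_Q * (if i = 0 \<and> j = 0 then osc_ec * osc_ec else 0)
         + osc_U (- i) * (if j = 0 then osc_ec else 0) - (if i = 0 then osc_Q * (if j = 0 then osc_ec else 0) else 0))"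
proof -
  have "osc_D (- i) * osc_D j \<doteq> (if i = 0 \<and> j = 0 then osc_ec * osc_ec else 0)"
    using osc_D_D_cong[of "- i" j] by simp
  moreover have "osc_D (- i) \<doteq> (if i = 0 then osc_ec else 0)"
    using osc_D_cong[of "- i"] by simp
  moreover have "(if i = 0 then osc_Q * osc_D j else 0) \<doteq> (if i = 0 then osc_Q * (if j = 0 then osc_ec else 0) else 0)"
    using osc_cong_mult_left[OF osc_D_cong] by (auto intro: osc_cong_refl)
  ultimately show ?thesis
    unfolding osc_rep_S_expand
    by (intro osc_cong_add osc_cong_diff osc_cong_refl osc_cong_mult_left osc_D_cong)
qed

text \<open>The image of a constant under \<open>E_l\<close> contains a multiple of
  \<open>z_l\<close>, so products \<open>S_{i,l} E_l\<close> require the action of \<open>S\<close>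
  on linear monomials.\<close>

lemma osc_rep_S_Z_cong:
  assumes "j \<noteq> 0" "l \<noteq> 0"
  shows "fps_map osc_rep (y3_S i j) * osc_Z l \<doteq> emb_S i j * osc_Z l + pole_p * (osc_V i * (if j = l then 1 else 0))
     - pole_q * (osc_U j * (if i = 0 then osc_Z l * osc_ec - osc_Z l else if - i = l then 1 else 0))
     - pole_p * pole_q * (osc_Q * (if i = 0 \<and> j = l then osc_ec else 0)
         + osc_U (- i) * (if j = l then 1 else 0) - (if i = 0 then osc_Q * (if j = l then 1 else 0) else 0))"
proof -
  have 1: "osc_D (- i) * osc_D j * osc_Z l \<doteq> (if i = 0 \<and> j = l then osc_ec else 0)"
    using osc_D_D_Z_cong[OF assms, of "- i"] by simp
  have 2: "osc_D (- i) * osc_Z l \<doteq> (if i = 0 then osc_Z l * osc_ec - osc_Z l else if - i = l then 1 else 0)"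
    using osc_D_Z_cong[OF assms(2), of "- i"] by simp
  have 3: "osc_D j * osc_Z l \<doteq> (if j = l then 1 else 0)"
    using osc_D_Z_cong[OF assms(2), of j] assms(1) by simp
  have 4: "(if i = 0 then osc_Q * (osc_D j * osc_Z l) else 0) \<doteq> (if i = 0 then osc_Q * (if j = l then 1 else 0) else 0)"
    using osc_cong_mult_left[OF 3] by (auto intro: osc_cong_refl)
  have expand: "fps_map osc_rep (y3_S i j) * osc_Z l = emb_S i j * osc_Z l + pole_p * (osc_V i * (osc_D j * osc_Z l))
     - pole_q * (osc_U j * (osc_D (- i) * osc_Z l))
     - pole_p * pole_q * (osc_Q * (osc_D (- i) * osc_D j * osc_Z l) + osc_U (- i) * (osc_D j * osc_Z l)
        - (if i = 0 then osc_Q * (osc_D j * osc_Z l) else 0))"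
    unfolding osc_rep_S_expand by (simp add: left_diff_distrib distrib_right mult.assoc)
  show ?thesis
    unfolding expand by (intro osc_cong_add osc_cong_diff osc_cong_refl osc_cong_mult_left 1 2 3 4)
qed

section \<open>The action of \<open>E\<close> and \<open>G\<close> on constants\<close>

definition osc_c :: "osc_op fps" where
  "osc_c = fps_X * osc_ec"

lemma osc_scalar_c: "osc_scalar osc_c"
  by (simp add: osc_c_def osc_scalar_mult osc_scalar_X osc_scalar_ec)

text \<open>Since \<open>1 + 2 p = u/(u-2)\<close>, multiplying it by \<open>e/u\<close> gives
  exactly \<open>p e\<close>.\<close>

lemma pole_p_cancel: "(1 + pole_p + pole_p) * B * osc_c = pole_p * (B * osc_ec)"
proof -
  have "(1 + pole_p + pole_p) * B * osc_c = fps_X * (1 + pole_p + pole_p) * (B * osc_ec)"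
    unfolding osc_c_def by (simp only: mult.assoc central_left_commute[OF central_fps_X])
  then show ?thesis
    by (simp only: pole_p_eq[symmetric])
qed

lemma sum_UNIV_3: "(\<Sum>i\<in>UNIV. f i) = f (- 1) + f 0 + f (1 :: 3)"
  unfolding UNIV_3 using minus_one_neq_one_3 by (simp add: add.assoc)

definition emb_E :: "3 \<Rightarrow> osc_op fps" where
  "emb_E j = (if j = 0 then 0 else fps_map osc_emb (y3_E (pm_of j)))"

text \<open>The proposed value of \<open>E_j(u)\<close> on constants, namely
  \<open>E_j (1 + e/u) + z_j e/u\<close>; \<open>osc_rep_S_W_cong\<close> verifies that it solves
  the linear system characterising \<open>E\<close>.\<close>

definition osc_W :: "3 \<Rightarrow> osc_op fps" where
  "osc_W j = emb_E j * (1 + osc_c) + osc_Z j * osc_c"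

lemma osc_scalar_emb_E: "osc_scalar (emb_E j * (1 + osc_c))"
proof -
  have "osc_scalar (emb_E j)"
    by (auto simp: emb_E_def osc_scalar_emb) (simp add: osc_scalar_def osc_coef_closed)
  then show ?thesis
    by (intro osc_scalar_mult osc_scalar_add osc_scalar_1 osc_scalar_c)
qed

lemma osc_rep_S_W_cong:
  assumes i: "i \<noteq> 0" and E: "emb_S i (- 1) * emb_E (- 1) + emb_S i 1 * emb_E 1 = emb_S i 0"
  shows "fps_map osc_rep (y3_S i (- 1)) * osc_W (- 1) + fps_map osc_rep (y3_S i 1) * osc_W 1
    \<doteq> fps_map osc_rep (y3_S i 0)"
proof -
  let ?B = "osc_V i - pole_q * osc_U (- i)"
  let ?val = "\<lambda>j. emb_S i j * osc_Z j + pole_p * osc_V i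
       - pole_q * (osc_U j * (if - i = j then 1 else 0)) - pole_p * (pole_q * osc_U (- i))"
  have W: "fps_map osc_rep (y3_S i j) * osc_W j \<doteq> emb_S i j * (emb_E j * (1 + osc_c)) + ?val j * osc_c"
    if j: "j \<noteq> 0" for j
  proof -
    have "fps_map osc_rep (y3_S i j) * (emb_E j * (1 + osc_c)) \<doteq> emb_S i j * (emb_E j * (1 + osc_c))"
      using osc_cong_mult_right[OF osc_rep_S_cong osc_scalar_emb_E, of i j] i j by simp
    moreover have "fps_map osc_rep (y3_S i j) * osc_Z j * osc_c \<doteq> ?val j * osc_c"
      using osc_cong_mult_right[OF osc_rep_S_Z_cong[OF j j] osc_scalar_c, of i] i by (simp add: mult.assoc)
    ultimately show ?thesis
      unfolding osc_W_def distrib_left by (simp only: mult.assoc osc_cong_add)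
  qed
  have i': "i = 1 \<or> i = - 1"
    using i index_3_cases by blast
  \<comment> \<open>Each of \<open>j = 1\<close> and \<open>j = -1\<close> contributes
    \<open>p\<close> times \<open>osc_V i\<close>, and the terms \<open>emb_S i j * osc_Z j\<close>
    supply \<open>osc_V i\<close> up to the missing index 0. This yields the factor
    \<open>1 + 2 p\<close>.\<close>
  have val: "?val (- 1) + ?val 1 = (1 + pole_p + pole_p) * ?B - emb_S i 0"
    using i' by (auto simp: osc_V_def sum_UNIV_3 osc_Z_0 algebra_simps)
  have "fps_map osc_rep (y3_S i (- 1)) * osc_W (- 1) + fps_map osc_rep (y3_S i 1) * osc_W 1
    \<doteq> (emb_S i (- 1) * (emb_E (- 1) * (1 + osc_c)) + ?val (- 1) * osc_c)
      + (emb_S i 1 * (emb_E 1 * (1 + osc_c)) + ?val 1 * osc_c)"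
    by (intro osc_cong_add W) simp_all
  also have "\<dots> = (emb_S i (- 1) * emb_E (- 1) + emb_S i 1 * emb_E 1) * (1 + osc_c) + (?val (- 1) + ?val 1) * osc_c"
    by (simp only: distrib_right mult.assoc add_ac)
  also have "\<dots> = emb_S i 0 + pole_p * (?B * osc_ec)"
    unfolding E val by (simp add: left_diff_distrib[of _ "emb_S i 0"] pole_p_cancel distrib_left)
  also have "\<dots> \<doteq> fps_map osc_rep (y3_S i 0)"
    using osc_cong_sym[OF osc_rep_S_cong[of i 0]] i
    by (simp add: left_diff_distrib right_diff_distrib mult.assoc add_diff_eq)
  finally show ?thesis .
qed

lemma osc_rep_G_cong:
  assumes E: "\<And>a. a \<noteq> 0 \<Longrightarrow> emb_S a (- 1) * emb_E (- 1) + emb_S a 1 * emb_E 1 = emb_S a 0"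
    and G: "G = emb_S 0 0 - (emb_S 0 (- 1) * emb_E (- 1) + emb_S 0 1 * emb_E 1)"
  shows "fps_map osc_rep (y3_S 0 0) - (fps_map osc_rep (y3_S 0 (- 1)) * osc_W (- 1) + fps_map osc_rep (y3_S 0 1) * osc_W 1)
    \<doteq> G * (1 - pole_q * osc_ec) * (1 + osc_c)"
proof -
  let ?w = "pole_q * osc_ec"
  have p: "x * (pole_p * y) = pole_p * (x * y)" and q: "x * (pole_q * y) = pole_q * (x * y)" for x y :: "osc_op fps"
    by (simp_all only: central_left_commute[OF central_pole_p] central_left_commute[OF central_pole_q])
  \<comment> \<open>The common factor of \<open>pole_p\<close>: it appears times \<open>e\<close> in
    the action of \<open>S_{0,0}\<close> and times \<open>1 + 2 p\<close> in the sum of the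
    \<open>?val\<close>, so \<open>pole_p_cancel\<close> makes both occurrences cancel.\<close>
  let ?B = "osc_V 0 - pole_q * (osc_Q * osc_ec - osc_Q + osc_U 0)"
  let ?val = "\<lambda>j. emb_S 0 j * osc_Z j + pole_p * osc_V 0
     - pole_q * (osc_U j * (osc_Z j * osc_ec - osc_Z j)) - pole_p * pole_q * (osc_Q * osc_ec + osc_U 0 - osc_Q)"
  have W: "fps_map osc_rep (y3_S 0 j) * osc_W j
      \<doteq> (emb_S 0 j - pole_q * (osc_U j * osc_ec)) * (emb_E j * (1 + osc_c)) + ?val j * osc_c"
    if j: "j \<noteq> 0" for j
  proof -
    have "fps_map osc_rep (y3_S 0 j) * (emb_E j * (1 + osc_c))
        \<doteq> (emb_S 0 j - pole_q * (osc_U j * osc_ec)) * (emb_E j * (1 + osc_c))"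
      using osc_cong_mult_right[OF osc_rep_S_cong osc_scalar_emb_E, of 0 j] j by simp
    moreover have "fps_map osc_rep (y3_S 0 j) * osc_Z j * osc_c \<doteq> ?val j * osc_c"
      using osc_cong_mult_right[OF osc_rep_S_Z_cong[OF j j] osc_scalar_c, of 0] by simp
    ultimately show ?thesis
      unfolding osc_W_def distrib_left by (simp only: mult.assoc osc_cong_add)
  qed
  have QU: "osc_Q = osc_U (- 1) * osc_Z (- 1) + osc_U 0 + osc_U 1 * osc_Z 1"
    by (simp add: osc_Q_def osc_U_def sum_UNIV_3 osc_Z_0 distrib_right mult.assoc add_ac)
  have val: "?val (- 1) + ?val 1 = (1 + pole_p + pole_p) * ?B - emb_S 0 0 + pole_q * (osc_U 0 * osc_ec)"
  proof -
    have V: "osc_V 0 = emb_S 0 (- 1) * osc_Z (- 1) + emb_S 0 0 + emb_S 0 1 * osc_Z 1"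
      by (simp add: osc_V_def sum_UNIV_3 osc_Z_0)
    have "osc_U (- 1) * (osc_Z (- 1) * osc_ec - osc_Z (- 1)) + osc_U 1 * (osc_Z 1 * osc_ec - osc_Z 1)
        = osc_Q * osc_ec - osc_Q - osc_U 0 * osc_ec + osc_U 0"
      unfolding QU by (simp add: algebra_simps)
    then have "pole_q * (osc_U (- 1) * (osc_Z (- 1) * osc_ec - osc_Z (- 1)))
      + pole_q * (osc_U 1 * (osc_Z 1 * osc_ec - osc_Z 1))
      = pole_q * (osc_Q * osc_ec - osc_Q + osc_U 0) - pole_q * (osc_U 0 * osc_ec)"
      by (simp add: algebra_simps flip: distrib_left)
    moreover have "emb_S 0 (- 1) * osc_Z (- 1) + emb_S 0 1 * osc_Z 1 = osc_V 0 - emb_S 0 0"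
      unfolding V by simp
    moreover have "pole_p * pole_q * (osc_Q * osc_ec + osc_U 0 - osc_Q) = pole_p * (pole_q * (osc_Q * osc_ec - osc_Q + osc_U 0))"
      by (simp add: mult.assoc algebra_simps)
    ultimately show ?thesis
      by (simp add: algebra_simps)
  qed
  \<comment> \<open>Here \<open>G\<close> enters: by \<open>E\<close>, the rows
    \<open>a \<noteq> 0\<close> of the contraction give \<open>emb_S a 0\<close>, while row 0 falls
    short of \<open>emb_S 0 0\<close> by \<open>G\<close>.\<close>
  have UE: "osc_U (- 1) * emb_E (- 1) + osc_U 1 * emb_E 1 = osc_U 0 - G"
  proof -
    have ZE: "osc_Z a * emb_E j = emb_E j * osc_Z a" for a j
      by (simp add: emb_E_def osc_emb_Z)
    have "osc_U (- 1) * emb_E (- 1) + osc_U 1 * emb_E 1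
      = (\<Sum>a\<in>UNIV. (emb_S a (- 1) * emb_E (- 1) + emb_S a 1 * emb_E 1) * osc_Z (- a))"
      by (simp add: osc_U_def sum_distrib_right distrib_right mult.assoc ZE sum.distrib)
    also have "\<dots> = osc_U 0 - G"
      by (simp add: sum_UNIV_3 E G osc_U_def osc_Z_0)
    finally show ?thesis .
  qed
  have ecE: "osc_ec * emb_E j = emb_E j * osc_ec" for j
    by (simp add: emb_E_def osc_emb_ec)
  let ?t = "\<lambda>j. (emb_S 0 j - pole_q * (osc_U j * osc_ec)) * (emb_E j * (1 + osc_c))"
  have t: "?t (- 1) + ?t 1 = (emb_S 0 0 - G) * (1 + osc_c) - (osc_U 0 - G) * (?w * (1 + osc_c))"
  proof -
    have "pole_q * (osc_U j * osc_ec) * (emb_E j * (1 + osc_c)) = osc_U j * emb_E j * (?w * (1 + osc_c))" for j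
    proof -
      have "osc_U j * osc_ec * (emb_E j * (1 + osc_c)) = osc_U j * emb_E j * osc_ec * (1 + osc_c)"
        by (metis ecE mult.assoc)
      then have "pole_q * (osc_U j * osc_ec) * (emb_E j * (1 + osc_c)) = pole_q * (osc_U j * emb_E j * osc_ec * (1 + osc_c))"
        by (simp only: mult.assoc)
      also have "\<dots> = osc_U j * emb_E j * (?w * (1 + osc_c))"
        by (simp only: mult.assoc q)
      finally show ?thesis .
    qed
    then have "?t (- 1) + ?t 1 = (emb_S 0 (- 1) * emb_E (- 1) + emb_S 0 1 * emb_E 1) * (1 + osc_c)
        - (osc_U (- 1) * emb_E (- 1) + osc_U 1 * emb_E 1) * (?w * (1 + osc_c))"
      by (simp only: left_diff_distrib distrib_right mult.assoc) (simp only: algebra_simps)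
    moreover have "emb_S 0 (- 1) * emb_E (- 1) + emb_S 0 1 * emb_E 1 = emb_S 0 0 - G"
      by (simp add: G)
    ultimately show ?thesis
      by (simp only: UE)
  qed
  have S00: "fps_map osc_rep (y3_S 0 0) \<doteq> emb_S 0 0 + pole_p * (?B * osc_ec) - osc_U 0 * ?w"
  proof -
    have eq: "emb_S 0 0 + pole_p * (?B * osc_ec) - osc_U 0 * ?w
        = emb_S 0 0 + pole_p * (osc_V 0 * osc_ec) - pole_q * (osc_U 0 * osc_ec)
        - pole_p * pole_q * (osc_Q * (osc_ec * osc_ec) + osc_U 0 * osc_ec - osc_Q * osc_ec)"
      by (simp add: q algebra_simps)
    show ?thesis
      unfolding eq using osc_rep_S_cong[of 0 0] by simp
  qed
  have "fps_map osc_rep (y3_S 0 0) - (fps_map osc_rep (y3_S 0 (- 1)) * osc_W (- 1) + fps_map osc_rep (y3_S 0 1) * osc_W 1)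
    \<doteq> (emb_S 0 0 + pole_p * (?B * osc_ec) - osc_U 0 * ?w)
      - ((?t (- 1) + ?val (- 1) * osc_c) + (?t 1 + ?val 1 * osc_c))"
    by (intro osc_cong_add osc_cong_diff W S00) simp_all
  also have "\<dots> = (emb_S 0 0 + pole_p * (?B * osc_ec) - osc_U 0 * ?w)
      - ((?t (- 1) + ?t 1) + (?val (- 1) + ?val 1) * osc_c)"
    by (simp only: distrib_right add_ac)
  also have "(?val (- 1) + ?val 1) * osc_c = pole_p * (?B * osc_ec) - emb_S 0 0 * osc_c + osc_U 0 * (?w * osc_c)"
    unfolding val left_diff_distrib[of _ "emb_S 0 0"] distrib_right[of _ "pole_q * (osc_U 0 * osc_ec)"] pole_p_cancel
    by (simp only: mult.assoc q)
  also have "(emb_S 0 0 + pole_p * (?B * osc_ec) - osc_U 0 * ?w)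
      - ((?t (- 1) + ?t 1) + (pole_p * (?B * osc_ec) - emb_S 0 0 * osc_c + osc_U 0 * (?w * osc_c)))
      = G * (1 - ?w) * (1 + osc_c)"
    unfolding t by (simp only: left_diff_distrib right_diff_distrib distrib_left distrib_right mult_1_right mult.assoc)
       (simp add: algebra_simps)
  finally show ?thesis .
qed

lemma pm_index_pm_of: "pm_index (pm_of (- 1)) = - 1" "pm_index (pm_of 1) = 1"
  by (auto intro: pm_of_inverse)

lemma pm_index_nonzero: "pm_index a \<noteq> 0"
  using pm_index[of a] by auto

lemma pm_of_index: "pm_of (pm_index a) = a"
  by (rule pm_index_inverse)

lemma sum_UNIV_pm: "(\<Sum>a\<in>UNIV. f a) = f (pm_of (- 1)) + f (pm_of 1)"
proof -
  have "a \<in> {pm_of (- 1), pm_of 1}" for a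
    using pm_index[of a] pm_of_index[of a] by auto
  then have U: "(UNIV :: pm set) = {pm_of (- 1), pm_of 1}"
    by blast
  have "pm_of (- 1) \<noteq> pm_of 1"
    by (metis pm_index_pm_of minus_one_neq_one_3)
  then show ?thesis
    unfolding U by (subst sum.insert) auto
qed

text \<open>Multiplication by \<open>D\<close> removes the inverse and leaves the linear system that
  both the embedded and the represented series satisfy.\<close>

lemma y3_D_E: "(\<Sum>b\<in>UNIV. y3_D $ a $ b * y3_E b) = y3_S (pm_index a) 0"
proof -
  have "(\<Sum>b\<in>UNIV. y3_D $ a $ b * y3_E b)
      = (\<Sum>c\<in>UNIV. (y3_D ** y3_Dtilde) $ a $ c * y3_S (pm_index c) 0)"
    unfolding y3_E_def matrix_matrix_mult_def
    by (simp add: sum_distrib_left sum_distrib_right mult.assoc) (rule sum.swap)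
  then show ?thesis
    by (simp add: y3_D_Dtilde mat_def if_distrib[of "\<lambda>x. x * _"] cong: if_cong)
qed

text \<open>With \<open>E\<close> as the rightmost factor, its value on constants can be inserted by
  left multiplication alone.\<close>

lemma y3_G_eq: "y3_G = y3_S 0 0 - (\<Sum>a\<in>UNIV. y3_S 0 (pm_index a) * y3_E a)"
  by (simp add: y3_G_def y3_E_def sum_distrib_left mult.assoc)

lemma emb_E_pm_index: "emb_E (pm_index a) = fps_map osc_emb (y3_E a)"
  by (simp add: emb_E_def pm_index_nonzero pm_of_index)

lemma emb_S_E: "a \<noteq> 0 \<Longrightarrow> emb_S a (- 1) * emb_E (- 1) + emb_S a 1 * emb_E 1 = emb_S a 0"
proof -
  assume "a \<noteq> 0"
  then have a: "a = pm_index (pm_of a)"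
    using index_3_cases[of a] pm_index_pm_of by auto
  have "fps_map osc_emb (\<Sum>b\<in>UNIV. y3_D $ pm_of a $ b * y3_E b) = emb_S a 0"
    unfolding y3_D_E a[symmetric] ..
  then show ?thesis
    by (simp add: sum_UNIV_pm fps_map_add[OF alg_hom_osc_emb] fps_map_mult[OF alg_hom_osc_emb]
        y3_D_def pm_index_pm_of a[symmetric] emb_E_def)
qed

text \<open>The system is solved by applying the image of \<open>y3_Dtilde\<close> from the left,
  where the congruence is stable; then \<open>y3_Dtilde_D\<close> collapses the double sum.\<close>

lemma osc_rep_E_cong: "fps_map osc_rep (y3_E i) \<doteq> osc_W (pm_index i)"
proof -
  let ?R = "fps_map osc_rep" and ?W = "\<lambda>b. osc_W (pm_index b)"
  have W: "?R (y3_S (pm_index a) 0) \<doteq> (\<Sum>b\<in>UNIV. ?R (y3_D $ a $ b) * ?W b)" for a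
    using osc_cong_sym[OF osc_rep_S_W_cong[OF pm_index_nonzero emb_S_E[OF pm_index_nonzero]], of a]
    by (simp add: sum_UNIV_pm y3_D_def pm_index_pm_of)
  have "?R (y3_E i) = (\<Sum>a\<in>UNIV. ?R (y3_Dtilde $ i $ a) * ?R (y3_S (pm_index a) 0))"
    by (simp add: y3_E_def fps_map_sum[OF alg_hom_osc_rep] fps_map_mult[OF alg_hom_osc_rep])
  also have "\<dots> \<doteq> (\<Sum>a\<in>UNIV. ?R (y3_Dtilde $ i $ a) * (\<Sum>b\<in>UNIV. ?R (y3_D $ a $ b) * ?W b))"
    by (intro osc_cong_sum osc_cong_mult_left W)
  also have "\<dots> = (\<Sum>b\<in>UNIV. ?R ((y3_Dtilde ** y3_D) $ i $ b) * ?W b)"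
    unfolding matrix_matrix_mult_def
    by (simp add: fps_map_sum[OF alg_hom_osc_rep] fps_map_mult[OF alg_hom_osc_rep]
        sum_distrib_left sum_distrib_right mult.assoc) (rule sum.swap)
  also have "\<dots> = ?W i"
    by (simp add: y3_Dtilde_D mat_def fps_map_0[OF alg_hom_osc_rep] fps_map_1[OF alg_hom_osc_rep]
        if_distrib[of ?R] if_distrib[of "\<lambda>x. x * _"] cong: if_cong)
  finally show ?thesis .
qed

lemma osc_rep_y3_G_cong:
  "fps_map osc_rep y3_G \<doteq> fps_map osc_emb y3_G * (1 - pole_q * osc_ec) * (1 + osc_c)"
proof -
  let ?R = "fps_map osc_rep"
  have "?R y3_G = ?R (y3_S 0 0) - (\<Sum>a\<in>UNIV. ?R (y3_S 0 (pm_index a)) * ?R (y3_E a))"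
    by (simp add: y3_G_eq fps_map_diff[OF alg_hom_osc_rep] fps_map_sum[OF alg_hom_osc_rep]
        fps_map_mult[OF alg_hom_osc_rep])
  also have "\<dots> \<doteq> ?R (y3_S 0 0) - (\<Sum>a\<in>UNIV. ?R (y3_S 0 (pm_index a)) * osc_W (pm_index a))"
    by (intro osc_cong_diff osc_cong_refl osc_cong_sum osc_cong_mult_left osc_rep_E_cong)
  also have "\<dots> \<doteq> fps_map osc_emb y3_G * (1 - pole_q * osc_ec) * (1 + osc_c)"
  proof -
    have "fps_map osc_emb y3_G = emb_S 0 0 - (emb_S 0 (- 1) * emb_E (- 1) + emb_S 0 1 * emb_E 1)"
      by (simp add: y3_G_eq sum_UNIV_pm fps_map_diff[OF alg_hom_osc_emb] fps_map_add[OF alg_hom_osc_emb]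
          fps_map_mult[OF alg_hom_osc_emb] pm_index_pm_of emb_E_def)
    from osc_rep_G_cong[OF emb_S_E this] show ?thesis
      by (simp add: sum_UNIV_pm pm_index_pm_of)
  qed
  finally show ?thesis .
qed

section \<open>Elements that act on the constants by a left multiplication\<close>

definition osc_diagonal :: "y3 \<Rightarrow> osc_coeff \<Rightarrow> bool" where
  "osc_diagonal P a \<longleftrightarrow> (\<forall>r. osc_apply (osc_rep P) (osc_const r) = osc_const (a * r))"

lemma osc_diagonal_add: "osc_diagonal P a \<Longrightarrow> osc_diagonal Q b \<Longrightarrow> osc_diagonal (P + Q) (a + b)"
  by (auto simp: osc_diagonal_def alg_hom_add[OF alg_hom_osc_rep] plus_osc_op.rep_eq osc_const_def distrib_right)

lemma osc_diagonal_mult: "osc_diagonal P a \<Longrightarrow> osc_diagonal Q b \<Longrightarrow> osc_diagonal (P * Q) (a * b)"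
  by (auto simp: osc_diagonal_def alg_hom_mult[OF alg_hom_osc_rep] times_osc_op.rep_eq mult.assoc)

lemma osc_diagonal_scaleC: "osc_diagonal P a \<Longrightarrow> osc_diagonal (c *\<^sub>C P) (c *\<^sub>C a)"
  by (auto simp: osc_diagonal_def alg_hom_scaleC[OF alg_hom_osc_rep] scaleC_osc_op.rep_eq osc_const_def
      mult_scaleC_left scaleC_zero_right)

lemma osc_diagonal_one: "osc_diagonal 1 1"
  by (simp add: osc_diagonal_def alg_hom_one[OF alg_hom_osc_rep] one_osc_op.rep_eq)

lemma osc_diagonal_coef: "fps_map osc_rep F \<doteq> B \<Longrightarrow> B $$ m = osc_coef a \<Longrightarrow> osc_diagonal (F $$ m) a"
  unfolding osc_cong_def osc_diagonal_def by (metis fps_map_nth osc_coef_const)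

section \<open>The homomorphism\<close>

text \<open>A multiplier is recovered by letting it act on the constant 1. The function is total on
  \<open>Y_3\<close> but is controlled only where \<open>osc_diagonal\<close> holds.\<close>

definition baby_comult :: "y3 \<Rightarrow> osc_coeff" where
  "baby_comult P = osc_apply (osc_rep P) (osc_const 1) (\<lambda>_. 0)"

lemma baby_comult_eq: "osc_diagonal P a \<Longrightarrow> baby_comult P = a"
  by (simp add: osc_diagonal_def baby_comult_def) (simp add: osc_const_def)

lemma tensor_of_osc_e: "(y \<otimes>\<^sub>C b) * osc_e = y \<otimes>\<^sub>C (b * ugl_e 0 0)"
  by (simp add: osc_e_def tensor_of_mult)

lemma baby_comult_D: "osc_diagonal (y3_D $ i $ j $$ m) ((y3_D $ i $ j $$ m) \<otimes>\<^sub>C 1)"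
proof (rule osc_diagonal_coef)
  show "fps_map osc_rep (y3_D $ i $ j) \<doteq> fps_map osc_emb (y3_D $ i $ j)"
    using osc_rep_S_cong[of "pm_index i" "pm_index j"] by (simp add: pm_index_nonzero y3_D_def)
qed (simp add: fps_map_nth osc_emb_def)

lemma mult_osc_c_nth: "(F * osc_c) $$ m = (if m = 0 then 0 else F $$ (m - 1) * osc_coef osc_e)"
proof -
  have "F * osc_c = fps_X * (F * osc_ec)"
    unfolding osc_c_def by (rule central_left_commute[OF central_fps_X])
  then show ?thesis
    by (simp add: osc_ec_def fps_mult_right_const_nth)
qed

lemma osc_emb_mult_coef_e: "osc_emb y * osc_coef osc_e = osc_coef (y \<otimes>\<^sub>C ugl_e 0 0)"
  by (simp add: osc_emb_def tensor_of_osc_e flip: alg_hom_mult[OF alg_hom_osc_coef])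

text \<open>The disturbing term \<open>z_i e/u\<close> lives in degree 1 alone, whence the bound on
  \<open>m\<close>.\<close>

lemma baby_comult_E:
  assumes "m > 1"
  shows "osc_diagonal (y3_E i $$ m) ((y3_E i $$ m) \<otimes>\<^sub>C 1 + (y3_E i $$ (m - 1)) \<otimes>\<^sub>C ugl_e 0 0)"
proof (rule osc_diagonal_coef[OF osc_rep_E_cong])
  have "osc_W (pm_index i) = fps_map osc_emb (y3_E i) + fps_map osc_emb (y3_E i) * osc_c + osc_Z (pm_index i) * osc_c"
    by (simp add: osc_W_def emb_E_pm_index distrib_left)
  then show "osc_W (pm_index i) $$ m = osc_coef ((y3_E i $$ m) \<otimes>\<^sub>C 1 + (y3_E i $$ (m - 1)) \<otimes>\<^sub>C ugl_e 0 0)"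
    using assms by (simp add: mult_osc_c_nth fps_map_nth osc_emb_mult_coef_e osc_Z_def
        alg_hom_add[OF alg_hom_osc_coef] flip: osc_emb_def)
qed

lemma pole_q_nth: "pole_q $$ n = (if n = 0 then 0 else (- 2) ^ (n - 1))"
  by (simp add: pole_q_def flip: power_minus)

text \<open>Translates the ring element -2 in the coefficients of \<open>pole_q\<close> into a
  complex scalar.\<close>

lemma mult_minus_2_power: "x * (- 2) ^ n = (- 2) ^ n *\<^sub>C (x :: 'a::{ring_1,complex_algebra})"
proof (induction n)
  case (Suc n)
  have 2: "y * (- 2) = (- 2) *\<^sub>C y" for y :: 'a
  proof -
    have "(- 2) *\<^sub>C y = - (y + y)"
      using scaleC_add_left[of "- 1" "- 1" y] by (simp add: scaleC_minus_one)
    then show ?thesis by (simp add: mult_2_right)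
  qed
  have "x * (- 2) ^ Suc n = (- 2) ^ n *\<^sub>C x * (- 2)"
    unfolding power_Suc2 mult.assoc[symmetric] Suc.IH ..
  also have "\<dots> = (- 2) ^ Suc n *\<^sub>C x"
    unfolding 2 scaleC_scaleC by simp
  finally show ?case .
qed (simp add: scaleC_one)

text \<open>In \<open>1/(u+2) - 1/u\<close> the degree 1 terms cancel, so the first sum starts at
  \<open>l = 1\<close>, with \<open>l\<close> one less than the degree; \<open>1/(u(u+2))\<close>
  starts in degree 2, which is \<open>l = 0\<close>. The additive conditions on \<open>l\<close>
  keep the index sets empty for small \<open>m\<close>, unaffected by truncated subtraction.\<close>

lemma emb_pole_q_nth:
  "(fps_map osc_emb F * (pole_q - fps_X)) $$ m
    = osc_emb (\<Sum>l\<in>{l. 1 \<le> l \<and> l + 1 \<le> m}. (- 2) ^ l *\<^sub>C (F $$ (m - l - 1)))" (is ?A)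
  "(fps_map osc_emb F * (fps_X * pole_q)) $$ m
    = osc_emb (\<Sum>l\<in>{l. l + 2 \<le> m}. (- 2) ^ l *\<^sub>C (F $$ (m - l - 2)))" (is ?B)
proof -
  have scale: "osc_emb (F $$ i) * (- 2) ^ l = osc_emb ((- 2) ^ l *\<^sub>C (F $$ i))" for i l
    by (simp add: mult_minus_2_power alg_hom_scaleC[OF alg_hom_osc_emb])
  have A: "(pole_q - fps_X :: osc_op fps) $$ n = (if n < 2 then 0 else (- 2) ^ (n - 1))" for n
    by (cases n; cases "n - 1") (simp_all add: pole_q_nth fps_X_def)
  have B: "(fps_X * pole_q :: osc_op fps) $$ n = (if n < 2 then 0 else (- 2) ^ (n - 2))" for n
    by (cases n; cases "n - 1") (simp_all add: pole_q_nth)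
  have restrict: "(\<Sum>i=0..m. f i) = (\<Sum>i\<in>{i. i + 2 \<le> m}. f i)" if "\<And>i. m < i + 2 \<Longrightarrow> f i = 0"
    for f :: "nat \<Rightarrow> osc_op"
    by (rule sum.mono_neutral_right) (use that in auto)
  have "(fps_map osc_emb F * (pole_q - fps_X)) $$ m
      = (\<Sum>i\<in>{i. i + 2 \<le> m}. osc_emb (F $$ i) * (pole_q - fps_X) $$ (m - i))"
    by (subst fps_mult_nth, unfold fps_map_nth, rule restrict) (auto simp: A simp del: fps_sub_nth)
  also have "\<dots> = (\<Sum>l\<in>{l. 1 \<le> l \<and> l + 1 \<le> m}. osc_emb (F $$ (m - l - 1)) * (- 2) ^ l)"
    by (rule sum.reindex_bij_witness[of _ "\<lambda>l. m - l - 1" "\<lambda>i. m - i - 1"])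
      (auto simp: A simp del: fps_sub_nth)
  finally show ?A
    by (simp add: scale alg_hom_sum[OF alg_hom_osc_emb])
  have "(fps_map osc_emb F * (fps_X * pole_q)) $$ m
      = (\<Sum>i\<in>{i. i + 2 \<le> m}. osc_emb (F $$ i) * (fps_X * pole_q) $$ (m - i))"
    by (subst fps_mult_nth, unfold fps_map_nth, rule restrict) (subst B, auto)
  also have "\<dots> = (\<Sum>l\<in>{l. l + 2 \<le> m}. osc_emb (F $$ (m - l - 2)) * (- 2) ^ l)"
    by (rule sum.reindex_bij_witness[of _ "\<lambda>l. m - l - 2" "\<lambda>i. m - i - 2"]) (auto simp: pole_q_nth)
  finally show ?B
    by (simp add: scale alg_hom_sum[OF alg_hom_osc_emb])
qed

lemma baby_comult_G:
  "osc_diagonal (y3_G $$ m) ((y3_G $$ m) \<otimes>\<^sub>C 1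
    - (\<Sum>l\<in>{l. 1 \<le> l \<and> l + 1 \<le> m}. (- 2) ^ l *\<^sub>C (y3_G $$ (m - l - 1))) \<otimes>\<^sub>C ugl_e 0 0
    - (\<Sum>l\<in>{l. l + 2 \<le> m}. (- 2) ^ l *\<^sub>C (y3_G $$ (m - l - 2))) \<otimes>\<^sub>C (ugl_e 0 0) ^ 2)"
proof (rule osc_diagonal_coef[OF osc_rep_y3_G_cong])
  let ?G = "fps_map osc_emb y3_G"
  \<comment> \<open>Expanding \<open>(1 - q e)(1 + e/u)\<close> and collecting powers of
    \<open>e\<close>, with \<open>q = 1/(u+2)\<close>.\<close>
  have "?G * (1 - pole_q * osc_ec) * (1 + osc_c)
      = ?G - ?G * (pole_q - fps_X) * osc_ec - ?G * (fps_X * pole_q) * osc_ec * osc_ec"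
  proof -
    have "pole_q * osc_ec * osc_c = fps_X * pole_q * osc_ec * osc_ec"
      unfolding osc_c_def by (simp only: mult.assoc central_left_commute[OF central_fps_X])
    then have "(1 - pole_q * osc_ec) * (1 + osc_c) = 1 - (pole_q - fps_X) * osc_ec - fps_X * pole_q * osc_ec * osc_ec"
      by (simp add: algebra_simps osc_c_def)
    then show ?thesis
      by (simp only: mult.assoc[of ?G]) (simp add: mult.assoc right_diff_distrib)
  qed
  then show "(?G * (1 - pole_q * osc_ec) * (1 + osc_c)) $$ m = osc_coef ((y3_G $$ m) \<otimes>\<^sub>C 1
    - (\<Sum>l\<in>{l. 1 \<le> l \<and> l + 1 \<le> m}. (- 2) ^ l *\<^sub>C (y3_G $$ (m - l - 1))) \<otimes>\<^sub>C ugl_e 0 0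
    - (\<Sum>l\<in>{l. l + 2 \<le> m}. (- 2) ^ l *\<^sub>C (y3_G $$ (m - l - 2))) \<otimes>\<^sub>C (ugl_e 0 0) ^ 2)"
    by (simp add: osc_ec_def fps_mult_right_const_nth emb_pole_q_nth osc_emb_mult_coef_e fps_map_nth
        alg_hom_diff[OF alg_hom_osc_coef] osc_emb_def tensor_of_osc_e power2_eq_square
        flip: alg_hom_mult[OF alg_hom_osc_coef])
qed

lemma fps_nth_in_shifted:
  "y3_D $ i $ j $$ m \<in> y3_plus_shifted k" "y3_G $$ m \<in> y3_plus_shifted k"
  "k < m \<Longrightarrow> y3_E l $$ m \<in> y3_plus_shifted k"
  unfolding y3_plus_shifted_def by (intro hull_inc; blast)+

lemma subalgebra_y3_plus_shifted: "subalgebra (y3_plus_shifted k)"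
  by (simp add: y3_plus_shifted_def subalgebra_hull)

lemma tensor_counit_osc: "tensor_counit (y \<otimes>\<^sub>C (1 :: 1 ugl)) = y"
  "tensor_counit (y \<otimes>\<^sub>C (ugl_e 0 0 :: 1 ugl)) = 0" "tensor_counit (y \<otimes>\<^sub>C (ugl_e 0 0 ^ 2 :: 1 ugl)) = 0"
  by (simp_all add: tensor_counit_pure ugl_counit_one ugl_counit_e ugl_counit_mult power2_eq_square
      scaleC_one scaleC_zero_left)

text \<open>The three claims about the multiplier travel together: the elements that have such an
  \<open>a\<close> form a subalgebra, so it is enough to inspect generators.\<close>

lemma baby_comult_shifted:
  assumes k: "k > 0" and P: "P \<in> y3_plus_shifted k"
  shows "\<exists>a. osc_diagonal P a \<and> a \<in> tensor_sub (y3_plus_shifted (k - 1)) UNIV \<and> tensor_counit a = P"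
proof -
  define B where "B = tensor_sub (y3_plus_shifted (k - 1)) (UNIV :: 1 ugl set)"
  let ?H = "{P. \<exists>a. osc_diagonal P a \<and> a \<in> B \<and> tensor_counit a = P}"
  have A: "subalgebra B"
    unfolding B_def by (rule subalgebra_tensor_sub[OF subalgebra_y3_plus_shifted])
  have pure: "y \<otimes>\<^sub>C b \<in> B" if "y \<in> y3_plus_shifted (k - 1)" for y b
    unfolding B_def using that by (rule tensor_of_in_tensor_sub)
  note counit = alg_hom_one[OF alg_hom_tensor_counit] alg_hom_add[OF alg_hom_tensor_counit]
    alg_hom_mult[OF alg_hom_tensor_counit] alg_hom_scaleC[OF alg_hom_tensor_counit]
    alg_hom_diff[OF alg_hom_tensor_counit] tensor_counit_osc
  have "subalgebra ?H"
    unfolding subalgebra_def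
  proof (intro conjI ballI allI)
    show "1 \<in> ?H"
      using osc_diagonal_one subalgebra_one[OF A] counit(1) by blast
  next
    fix P Q assume "P \<in> ?H" "Q \<in> ?H"
    then obtain a b where "osc_diagonal P a" "a \<in> B" "tensor_counit a = P"
      "osc_diagonal Q b" "b \<in> B" "tensor_counit b = Q"
      by blast
    then have "osc_diagonal (P + Q) (a + b)" "a + b \<in> B" "tensor_counit (a + b) = P + Q"
      "osc_diagonal (P * Q) (a * b)" "a * b \<in> B" "tensor_counit (a * b) = P * Q"
      by (simp_all add: osc_diagonal_add osc_diagonal_mult subalgebra_add[OF A] subalgebra_mult[OF A] counit)
    then show "P + Q \<in> ?H" "P * Q \<in> ?H"
      by blast+
  next
    fix c P assume "P \<in> ?H"
    then obtain a where "osc_diagonal P a" "a \<in> B" "tensor_counit a = P"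
      by blast
    then have "osc_diagonal (c *\<^sub>C P) (c *\<^sub>C a)" "c *\<^sub>C a \<in> B" "tensor_counit (c *\<^sub>C a) = c *\<^sub>C P"
      by (simp_all add: osc_diagonal_scaleC subalgebra_scaleC[OF A] counit)
    then show "c *\<^sub>C P \<in> ?H"
      by blast
  qed
  moreover have "y3_D $ i $ j $$ m \<in> ?H" for i j m
    using baby_comult_D[of i j m] by (auto simp: counit intro!: pure fps_nth_in_shifted)
  moreover have "y3_E l $$ r \<in> ?H" if "r > k" for l r
  proof -
    \<comment> \<open>The coefficient of degree \<open>r - 1\<close> is why the target is shifted by
      \<open>k - 1\<close> only; and \<open>r > k > 0\<close> excludes degree 1.\<close>
    have "(y3_E l $$ r) \<otimes>\<^sub>C 1 + (y3_E l $$ (r - 1)) \<otimes>\<^sub>C ugl_e 0 0 \<in> B"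
      using that k by (intro subalgebra_add[OF A] pure fps_nth_in_shifted) simp_all
    then show ?thesis
      using baby_comult_E[of r l] that k by (force simp: counit)
  qed
  moreover have "y3_G $$ m \<in> ?H" for m
  proof -
    note Y = subalgebra_y3_plus_shifted[of "k - 1"]
    let ?a = "(y3_G $$ m) \<otimes>\<^sub>C 1
    - (\<Sum>l\<in>{l. 1 \<le> l \<and> l + 1 \<le> m}. (- 2) ^ l *\<^sub>C (y3_G $$ (m - l - 1))) \<otimes>\<^sub>C ugl_e 0 0
    - (\<Sum>l\<in>{l. l + 2 \<le> m}. (- 2) ^ l *\<^sub>C (y3_G $$ (m - l - 2))) \<otimes>\<^sub>C (ugl_e 0 0) ^ 2 :: osc_coeff"
    have "?a \<in> B"
      by (intro subalgebra_diff[OF A] pure fps_nth_in_shifted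
          subalgebra_sum[OF Y] subalgebra_scaleC[OF Y])
    moreover have "tensor_counit ?a = y3_G $$ m"
      by (simp add: counit)
    ultimately show ?thesis
      using baby_comult_G[of m] by blast
  qed
  ultimately have "y3_plus_shifted k \<subseteq> ?H"
    unfolding y3_plus_shifted_def[of k] by (intro hull_minimal) auto
  then show ?thesis
    using P unfolding B_def by blast
qed

no_notation fps_nth (infixl \<open>$$\<close> 75)

theorem theorem1p4:
  fixes k :: nat
  assumes "k > 0"
  shows "\<exists>\<phi> :: y3 \<Rightarrow> (y3, 1 ugl) tensor.
      alg_hom_on (y3_plus_shifted k) \<phi>
    \<and> \<phi> ` y3_plus_shifted k \<subseteq> tensor_sub (y3_plus_shifted (k - 1)) UNIV
    \<and> inj_on \<phi> (y3_plus_shifted k)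
    \<and> (\<forall>i j m. \<phi> (fps_nth (y3_D $ i $ j) m) = fps_nth (y3_D $ i $ j) m \<otimes>\<^sub>C 1)
    \<and> (\<forall>i m. m > k \<longrightarrow>
         \<phi> (fps_nth (y3_E i) m) = fps_nth (y3_E i) m \<otimes>\<^sub>C 1 + fps_nth (y3_E i) (m - 1) \<otimes>\<^sub>C ugl_e 0 0)
    \<and> (\<forall>m. \<phi> (fps_nth y3_G m) =
         fps_nth y3_G m \<otimes>\<^sub>C 1
         - (\<Sum>l\<in>{l. 1 \<le> l \<and> l + 1 \<le> m}. (-2) ^ l *\<^sub>C fps_nth y3_G (m - l - 1)) \<otimes>\<^sub>C ugl_e 0 0
         - (\<Sum>l\<in>{l. l + 2 \<le> m}. (-2) ^ l *\<^sub>C fps_nth y3_G (m - l - 2)) \<otimes>\<^sub>C (ugl_e 0 0) ^ 2)"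
proof (intro exI[of _ baby_comult] conjI allI impI)
  \<comment> \<open>By \<open>baby_comult_eq\<close> the multiplier found for \<open>P\<close> is
    \<open>baby_comult P\<close> itself, so the counit is a left inverse.\<close>
  have P: "osc_diagonal P (baby_comult P)" "baby_comult P \<in> tensor_sub (y3_plus_shifted (k - 1)) UNIV"
    "tensor_counit (baby_comult P) = P" if "P \<in> y3_plus_shifted k" for P
    using baby_comult_shifted[OF assms that] baby_comult_eq by auto
  show "alg_hom_on (y3_plus_shifted k) baby_comult"
    unfolding alg_hom_on_def
    by (auto intro!: baby_comult_eq osc_diagonal_one osc_diagonal_add osc_diagonal_mult osc_diagonal_scaleC P)
  show "baby_comult ` y3_plus_shifted k \<subseteq> tensor_sub (y3_plus_shifted (k - 1)) UNIV"
    using P by blast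
  show "inj_on baby_comult (y3_plus_shifted k)"
    by (rule inj_on_inverseI) (rule P)
next
  fix i j m
  show "baby_comult (fps_nth (y3_D $ i $ j) m) = fps_nth (y3_D $ i $ j) m \<otimes>\<^sub>C 1"
    by (rule baby_comult_eq[OF baby_comult_D])
next
  fix i m
  assume "m > k"
  with assms show "baby_comult (fps_nth (y3_E i) m)
      = fps_nth (y3_E i) m \<otimes>\<^sub>C 1 + fps_nth (y3_E i) (m - 1) \<otimes>\<^sub>C ugl_e 0 0"
    by (intro baby_comult_eq[OF baby_comult_E]) simp
next
  fix m
  show "baby_comult (fps_nth y3_G m) = fps_nth y3_G m \<otimes>\<^sub>C 1
         - (\<Sum>l\<in>{l. 1 \<le> l \<and> l + 1 \<le> m}. (-2) ^ l *\<^sub>C fps_nth y3_G (m - l - 1)) \<otimes>\<^sub>C ugl_e 0 0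
         - (\<Sum>l\<in>{l. l + 2 \<le> m}. (-2) ^ l *\<^sub>C fps_nth y3_G (m - l - 2)) \<otimes>\<^sub>C (ugl_e 0 0) ^ 2"
    by (rule baby_comult_eq[OF baby_comult_G])
qed

end
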